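(* Let $N\ge2$, let $(p_i)_{i\ge1}$ be positive, $q_1,\dots,q_N>1$, and $0\le r<t$ integers. Let $\bm y\in\mathsf{W}_N$, let $x_0\in\mathbb{Z}$ with $x_0-1<y_N-N$, and set $x^{(0)}_i:=x_0-i$. Define the (signed) determinantal measure $$\mathbb{P}(\mathsf{X}_N\mid\bm y):=\frac1{\widehat Z_{(r,t]}}\Big(\prod_{k=1}^N\det\big(Q_k^\dagger(x_i^{(k-1)},x_j^{(k)})\big)_{i,j=1}^k\Big)\det\Big((-1)^{N-i}\Psi_i^{(N)}(x_j^{(N)})\Big)_{i,j=1}^N$$ on integer configurations $\mathsf{X}_N=\{x_j^{(i)}\}_{1\le j\le i\le N}$ with $x_{j+1}^{(i+1)}<x_j^{(i)}\le x_j^{(i+1)}$, where we set $x_k^{(k-1)}=x_k^{(0)}$ for $1\le k\le N$ and $\widehat Z_{(r,t]}:=Z_{(r,t]}\prod_{i=1}^Nq_i^{y_i-x_0}$. This measure does not depend on $x_0$, as long as $x_0-1<y_N-N$. Moreover, for $\bm y'\in\mathsf{W}_N$, the dTASEP probability $\mathcal{Q}_{(r,t]}(\bm y,\bm y')$ that particles starting from locations $(y_1-1>\dots>y_N-N)$ at time $r$ end up at locations $(y_1'-1>\dots>y_N'-N)$ at time $t$ is given by $$\mathcal{Q}_{(r,t]}(\bm y,\bm y')=\mathbb{P}\big((x_1^{(1)},x_2^{(2)},\dots,x_N^{(N)})=(y_1'-1,y_2'-2,\dots,y_N'-N)\;\big|\;\bm y\big),$$ i.e. the sum of $\mathbb{P}(\mathsf{X}_N\mid\bm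 y)$ over all configurations with $x_i^{(i)}=y_i'-i$ for $1\le i\le N$.
   Context: $\mathsf{W}_N=\{\bm y\in\mathbb{Z}^N:y_1\ge\dots\ge y_N\}$. $Z_{(r,t]}=\prod_{i=r+1}^t\prod_{j=1}^N(1+p_iq_j)$. dTASEP: particle positions $Y_1(s)>\dots>Y_N(s)$ in $\mathbb{Z}$ evolve by $Y_k(s)=\min\{Y_{k-1}(s)-1,\,Y_k(s-1)+W_{s,k}\}$, updated sequentially for $k=1,\dots,N$ (with $Y_0\equiv\infty$), where the $W_{s,k}$ are independent Bernoulli with $\mathbb{P}(W_{s,k}=1)=p_sq_k/(1+p_sq_k)$. Kernels on $\mathbb{Z}\times\mathbb{Z}$, composed by $(A\circ B)(x,z)=\sum_yA(x,y)B(y,z)$: $Q_i^\dagger(x,y)=q_i^{y-x}\mathbf{1}_{\{y\ge x\}}$; $Q_i^{-1}(x,y)=-\mathbf{1}_{y=x}+q_i\mathbf{1}_{y=x+1}$; $R_i(x,y)=\mathbf{1}_{y=x}+p_i\mathbf{1}_{y=x+1}$; $R_i^*(x,y)=R_i(y,x)$; $R^*_{(r,t]}=R_t^*\circ\cdots\circ R_{r+1}^*$; $Q^{-1}_{(k,N]}=Q_N^{-1}\circ\cdots\circ Q_{k+1}^{-1}$ (identity if $k=N$). For $1\le k\le N$, $\Psi_k^{(N)}(x):=\big(R^*_{(r,t]}\circ Q^{-1}_{(k,N]}\big)(x,y_k-k)$. *)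

theory Defs
  imports "HOL-Probability.Probability" "Jordan_Normal_Form.Determinant"
begin

(* Sequences indexed by 1..N (the parameters p and q, the points of W_N, particle positions)
   are functions on nat; their values outside the index range play no role. *)

definition weyl_chamber :: "nat \<Rightarrow> (nat \<Rightarrow> int) set" where
  "weyl_chamber N = {y. \<forall>i. 1 \<le> i \<and> i < N \<longrightarrow> y (Suc i) \<le> y i}"

definition Zpart :: "(nat \<Rightarrow> real) \<Rightarrow> (nat \<Rightarrow> real) \<Rightarrow> nat \<Rightarrow> nat \<Rightarrow> nat \<Rightarrow> real" where
  "Zpart p q N r t = (\<Prod>i\<in>{r<..t}. \<Prod>j\<in>{1..N}. 1 + p i * q j)"


section \<open>Discrete-time TASEP with Bernoulli jumps\<close>

(* The new positions are computed for k = 1, 2, ... in turn from the old positions Y and the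
   jump indicators w. The convention that particle 0 sits at infinity is built in by treating
   particle 1 separately; the value at index 0 is a dummy. *)
fun dtasep_step :: "(nat \<Rightarrow> bool) \<Rightarrow> (nat \<Rightarrow> int) \<Rightarrow> nat \<Rightarrow> int" where
  "dtasep_step w Y 0 = Y 0"
| "dtasep_step w Y (Suc k) =
     (if k = 0 then Y 1 + of_bool (w 1)
      else min (dtasep_step w Y k - 1) (Y (Suc k) + of_bool (w (Suc k))))"

(* dtasep w r Y0 s k is the position of particle k at time s >= r, started from Y0 at time r. *)
fun dtasep :: "(nat \<Rightarrow> nat \<Rightarrow> bool) \<Rightarrow> nat \<Rightarrow> (nat \<Rightarrow> int) \<Rightarrow> nat \<Rightarrow> nat \<Rightarrow> int" where
  "dtasep w r Y0 0 = Y0"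
| "dtasep w r Y0 (Suc s) =
     (if s < r then Y0 else dtasep_step (w (Suc s)) (dtasep w r Y0 s))"

(* A Bernoulli variable is represented by a bool-valued random variable, True standing for 1. *)
definition dtasep_noise ::
  "'w measure \<Rightarrow> (nat \<Rightarrow> real) \<Rightarrow> (nat \<Rightarrow> real) \<Rightarrow> nat \<Rightarrow> (nat \<Rightarrow> nat \<Rightarrow> 'w \<Rightarrow> bool) \<Rightarrow> bool" where
  "dtasep_noise M p q N W \<longleftrightarrow>
     prob_space M \<and>
     prob_space.indep_vars M (\<lambda>_. count_space UNIV) (\<lambda>(s, k). W s k) ({1..} \<times> {1..N}) \<and>
     (\<forall>s\<in>{1..}. \<forall>k\<in>{1..N}.
        distr M (count_space UNIV) (W s k)
          = measure_pmf (bernoulli_pmf (p s * q k / (1 + p s * q k))))"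

definition dtasep_prob ::
  "'w measure \<Rightarrow> (nat \<Rightarrow> nat \<Rightarrow> 'w \<Rightarrow> bool) \<Rightarrow> nat \<Rightarrow> nat \<Rightarrow> nat
     \<Rightarrow> (nat \<Rightarrow> int) \<Rightarrow> (nat \<Rightarrow> int) \<Rightarrow> real" where
  "dtasep_prob M W N r t y y' =
     measure M {\<omega>\<in>space M. \<forall>k\<in>{1..N}.
       dtasep (\<lambda>s k. W s k \<omega>) r (\<lambda>k. y k - int k) t k = y' k - int k}"


section \<open>Kernels on the integers\<close>

type_synonym kernel = "int \<Rightarrow> int \<Rightarrow> real"

definition kcomp :: "kernel \<Rightarrow> kernel \<Rightarrow> kernel" where
  "kcomp A B x z = (\<Sum>\<^sub>\<infinity>y. A x y * B y z)"

definition kid :: kernel where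
  "kid x y = (if y = x then 1 else 0)"

(* kprod K a b is the composition of K b, K (b - 1), ..., K (a + 1), in this order. *)
fun kprod :: "(nat \<Rightarrow> kernel) \<Rightarrow> nat \<Rightarrow> nat \<Rightarrow> kernel" where
  "kprod K a 0 = kid"
| "kprod K a (Suc b) = (if b < a then kid else kcomp (K (Suc b)) (kprod K a b))"

definition Qdag :: "real \<Rightarrow> kernel" where
  "Qdag c x y = (if y \<ge> x then c powi (y - x) else 0)"

definition Qinv :: "real \<Rightarrow> kernel" where
  "Qinv c x y = - (if y = x then 1 else 0) + c * (if y = x + 1 then 1 else 0)"

definition Rker :: "real \<Rightarrow> kernel" where
  "Rker c x y = (if y = x then 1 else 0) + c * (if y = x + 1 then 1 else 0)"

definition Rstar :: "real \<Rightarrow> kernel" where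
  "Rstar c x y = Rker c y x"

definition Psi ::
  "(nat \<Rightarrow> real) \<Rightarrow> (nat \<Rightarrow> real) \<Rightarrow> nat \<Rightarrow> nat \<Rightarrow> nat \<Rightarrow> (nat \<Rightarrow> int) \<Rightarrow> nat \<Rightarrow> int \<Rightarrow> real" where
  "Psi p q r t N y k x =
     kcomp (kprod (\<lambda>i. Rstar (p i)) r t) (kprod (\<lambda>i. Qinv (q i)) k N) x (y k - int k)"


section \<open>The determinantal measure on interlacing configurations\<close>

(* det of (f i j) with indices i, j running from 1 to k; library matrices are indexed from 0. *)
definition det1 :: "nat \<Rightarrow> (nat \<Rightarrow> nat \<Rightarrow> real) \<Rightarrow> real" where
  "det1 k f = Determinant.det (Matrix.mat k k (\<lambda>(i, j). f (Suc i) (Suc j)))"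

(* X (i, j) is the entry with upper (level) index i and lower index j. Configurations are
   extensional functions, so that each triangular array is counted exactly once in sums. *)
definition configs :: "nat \<Rightarrow> (nat \<times> nat \<Rightarrow> int) set" where
  "configs N = {X \<in> extensional {(i, j). 1 \<le> j \<and> j \<le> i \<and> i \<le> N}.
     \<forall>i j. 1 \<le> j \<and> j \<le> i \<and> i < N \<longrightarrow>
       X (Suc i, Suc j) < X (i, j) \<and> X (i, j) \<le> X (Suc i, j)}"

(* Entry i of level n, with the convention that the entries beyond the n-th (in particular all
   entries of level 0, and entry n + 1 of level n) are those of level 0, namely x0 - i. *)
definition entry :: "int \<Rightarrow> (nat \<times> nat \<Rightarrow> int) \<Rightarrow> nat \<Rightarrow> nat \<Rightarrow> int" where
  "entry x0 X n i = (if i \<le> n then X (n, i) else x0 - int i)"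

definition Zhat ::
  "(nat \<Rightarrow> real) \<Rightarrow> (nat \<Rightarrow> real) \<Rightarrow> nat \<Rightarrow> nat \<Rightarrow> nat \<Rightarrow> (nat \<Rightarrow> int) \<Rightarrow> int \<Rightarrow> real" where
  "Zhat p q r t N y x0 = Zpart p q N r t * (\<Prod>i\<in>{1..N}. q i powi (y i - x0))"

(* The mass that the signed measure gives to the single configuration X. *)
definition config_weight ::
  "(nat \<Rightarrow> real) \<Rightarrow> (nat \<Rightarrow> real) \<Rightarrow> nat \<Rightarrow> nat \<Rightarrow> nat \<Rightarrow> (nat \<Rightarrow> int) \<Rightarrow> int
     \<Rightarrow> (nat \<times> nat \<Rightarrow> int) \<Rightarrow> real" where
  "config_weight p q r t N y x0 X =
     1 / Zhat p q r t N y x0 *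
     (\<Prod>k\<in>{1..N}. det1 k (\<lambda>i j. Qdag (q k) (entry x0 X (k - 1) i) (entry x0 X k j))) *
     det1 N (\<lambda>i j. (- 1) ^ (N - i) * Psi p q r t N y i (entry x0 X N j))"

end

theory Submission
  imports Defs
begin

text \<open>
  The determinants of the kernels \<open>Qdag\<close> have triangular matrices: up to constants, a configuration
  weighs \<open>q k\<close> to the power (sum of row \<open>k\<close> minus sum of row \<open>k - 1\<close>), multiplied over \<open>k\<close>, times the
  determinant of the signed functions \<open>Psi\<close> at its top row (\<open>config_weight_eq\<close>). The base point
  \<open>x0\<close> enters only through the requirement that the last entry of row \<open>k\<close> be at least \<open>x0 - k\<close>. The
  support of \<open>Psi\<close> enforces this requirement whenever the last determinant is nonzero, and the powers of
  \<open>q\<close> that contain \<open>x0\<close> cancel against \<open>Zhat\<close>. This is the independence of \<open>x0\<close>.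
  
  For the identity with dTASEP, sum in two stages. For a fixed top row \<open>x\<close>, the longest one, let
  \<open>GT_sum q N f x\<close> be the weighted sum of \<open>f\<close>(diagonal) over the triangular patterns with this top row, and let \<open>F t f\<close> be the
  sum over \<open>x\<close> of \<open>GT_sum q N f x\<close> times the determinant of the time-\<open>t\<close> functions \<open>Psi\<close> at \<open>x\<close>. Then
  \<open>F t f\<close> equals, up to a constant factor, the expectation of \<open>f\<close> at the particle positions at time
  \<open>t\<close>, by induction on \<open>t\<close> for all \<open>f\<close> at once; the probability in question is the case of an indicator.
  
  At the initial time the determinant picks out a single diagonal (\<open>initial_condition\<close>): its last row
  is a point mass, and summing out the other entries of the top row telescopes and leaves the same
  determinant with one row and one column fewer.
  
  From time \<open>t\<close> to \<open>t + 1\<close> the functions \<open>Psi\<close> are convolved with the kernel of one Bernoulli jump. By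
  multilinearity the determinant becomes a sum over independent jumps of the entries of the top row,
  the collisions cancelling by antisymmetry (\<open>time_step\<close>). The core is \<open>intertwining\<close>: letting all entries
  of the top row jump in this way and then reading the diagonal gives the same weighted sum as
  reading the diagonal first and then performing one sequential step of dTASEP. It is proved
  row by row from \<open>row_exchange\<close>, where the refined statement that keeps track of the last entry of
  the longer row produces exactly the blocking rule \<open>min (position in front - 1) (own target)\<close>.
  
  The sums over all configurations reduce to finite sums because \<open>Psi\<close> has bounded support, and the law of
  the positions is a finite sum because only finitely many jump variables matter.
\<close>

section \<open>Exchanging interlacing with unit moves\<close>

definition unit_moves :: "nat \<Rightarrow> (nat \<Rightarrow> int) \<Rightarrow> (nat \<Rightarrow> int) set" where
  "unit_moves n x = PiE {1..n} (\<lambda>j. {x j..x j + 1})"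

definition interlaced :: "nat \<Rightarrow> (nat \<Rightarrow> int) \<Rightarrow> (nat \<Rightarrow> int) set" where
  "interlaced n x = PiE {1..n} (\<lambda>j. {x (Suc j)<..x j})"

definition strictly_decr :: "nat \<Rightarrow> (nat \<Rightarrow> int) \<Rightarrow> bool" where
  "strictly_decr n x \<longleftrightarrow> (\<forall>j. 1 \<le> j \<and> j < n \<longrightarrow> x (Suc j) < x j)"

abbreviation rowsum :: "nat \<Rightarrow> (nat \<Rightarrow> int) \<Rightarrow> int" where
  "rowsum n x \<equiv> (\<Sum>j\<in>{1..n}. x j)"

text \<open>
  The dTASEP update of the particle that follows particle \<open>n\<close> of the already updated state \<open>z\<close>, when
  it aims at the site \<open>m\<close>. For \<open>n = 0\<close> there is no particle in front.
\<close>

definition blocked :: "nat \<Rightarrow> (nat \<Rightarrow> int) \<Rightarrow> int \<Rightarrow> int" where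
  "blocked n z m = (if n = 0 then m else min (z n - 1) m)"

lemma finite_unit_moves [simp]: "finite (unit_moves n x)" and finite_interlaced [simp]: "finite (interlaced n x)"
  unfolding unit_moves_def interlaced_def by (auto intro!: finite_PiE)

lemma powi_rowsum_diff:
  fixes c :: real
  assumes "c \<noteq> 0"
  shows "c powi (rowsum n x - rowsum n y) = (\<Prod>j\<in>{1..n}. c powi (x j - y j))"
proof (induction n)
  case (Suc n)
  have *: "rowsum (Suc n) x - rowsum (Suc n) y = (rowsum n x - rowsum n y) + (x (Suc n) - y (Suc n))"
    by simp
  show ?case unfolding * power_int_add[OF disjI1[OF assms]] Suc by simp
qed simp

lemma sum_over_two_points:
  fixes g :: "int \<Rightarrow> real"
  shows "(\<Sum>m\<in>{m\<in>{a..a + 1}. P m}. g m) = of_bool (P a) * g a + of_bool (P (a + 1)) * g (a + 1)"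
proof -
  have "{a..a + 1} = {a, a + 1}" by auto
  then have "{m\<in>{a..a + 1}. P m} = (if P a then {a} else {}) \<union> (if P (a+1) then {a+1} else {})"
    by auto
  then show ?thesis by auto
qed

text \<open>
  The elementary step behind the intertwining. Both sides fix the old longer row \<open>lam\<close> and the new
  shorter row \<open>kap\<close>. On the left the longer row moves to some \<open>nu\<close> interlacing with \<open>kap\<close>; on the
  right the shorter row arrived at \<open>kap\<close> from some \<open>mu\<close> interlacing with \<open>lam\<close>, and the last entry of
  the longer row makes one blocked jump. The constraints on the entries decouple, so both sides are products
  of factors \<open>u\<close> (forced to move), \<open>1\<close> (forced to stay) and \<open>1 + u\<close> (free). An entry \<open>kap j\<close> that
  pushes \<open>lam j\<close> gives a factor \<open>u\<close> on both sides; an entry \<open>kap j\<close> that holds back \<open>lam (Suc j)\<close>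
  gives a factor \<open>1\<close> for entry \<open>Suc j\<close> on the left and for entry \<open>j\<close> on the right. So the two products
  over \<open>1..n\<close> differ only if \<open>kap n\<close> holds back the last entry of \<open>lam\<close>, and then by a factor \<open>1 + u\<close>.
  In that case both outcomes of the blocked jump lead to the same site, which supplies this factor.
\<close>

lemma row_exchange:
  fixes lam kap :: "nat \<Rightarrow> int" and u :: real and \<phi> :: "int \<Rightarrow> real"
  assumes u: "u > 0" and lam: "strictly_decr (Suc n) lam" and kap: "strictly_decr n kap"
    and ext: "kap \<in> extensional {1..n}"
    and win: "\<And>j. 1 \<le> j \<Longrightarrow> j \<le> n \<Longrightarrow> lam (Suc j) < kap j \<and> kap j \<le> lam j + 1"
  shows "(\<Sum>nu\<in>{nu\<in>unit_moves (Suc n) lam. kap \<in> interlaced n nu}.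
            u powi (rowsum (Suc n) nu - rowsum (Suc n) lam) * \<phi> (nu (Suc n)))
       = (\<Sum>mu\<in>{mu\<in>interlaced n lam. kap \<in> unit_moves n mu}. u powi (rowsum n kap - rowsum n mu))
           * (\<phi> (blocked n kap (lam (Suc n))) + u * \<phi> (blocked n kap (lam (Suc n) + 1)))"
proof -
  \<comment> \<open>\<open>A j\<close>: entry \<open>j\<close> is not pushed up by \<open>kap j\<close>. \<open>B j\<close>: entry \<open>Suc j\<close> is not held back by \<open>kap j\<close>.
    Then \<open>F j\<close> and \<open>G j\<close> are the factors of entry \<open>j\<close> on the left and on the right, and \<open>\<beta> m\<close> is the
    ratio of their partial products.\<close>
  define A where "A j \<longleftrightarrow> kap j \<le> lam j" for j
  define B where "B j \<longleftrightarrow> j = 0 \<or> lam (Suc j) + 1 < kap j" for j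
  define F :: "nat \<Rightarrow> real" where "F j = of_bool (A j) + u * of_bool (B (j - 1))" for j
  define G :: "nat \<Rightarrow> real" where "G j = of_bool (A j) + u * of_bool (B j)" for j
  define \<beta> where "\<beta> j = (if B j then 1 else 1 / (1 + u))" for j
  have AB: "A j \<or> B j" if "1 \<le> j" "j \<le> n" for j
    using win[OF that] lam that unfolding A_def B_def strictly_decr_def by force
  have AB': "A (Suc j) \<or> B j" if "Suc j \<le> n" for j
  proof (cases "j = 0")
    case False
    then have "kap (Suc j) < kap j" using kap that by (auto simp: strictly_decr_def)
    then show ?thesis using win[of "Suc j"] that by (auto simp: A_def B_def)
  qed (simp add: B_def)
  have FG: "(\<Prod>j\<in>{1..m}. G j) = \<beta> m * (\<Prod>j\<in>{1..m}. F j)" if "m \<le> n" for m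
    using that
  proof (induction m)
    case 0
    then show ?case by (simp add: \<beta>_def B_def)
  next
    case (Suc m)
    have "1 + u \<noteq> 0" using u by linarith
    then have "G (Suc m) * \<beta> m = \<beta> (Suc m) * F (Suc m)"
      using AB[of "Suc m"] AB'[of m] Suc.prems u
      by (auto simp: G_def F_def \<beta>_def)
    then show ?case using Suc by (simp add: ac_simps)
  qed
  define S where "S j = {m\<in>{lam j..lam j + 1}. (j \<le> n \<longrightarrow> kap j \<le> m) \<and> (2 \<le> j \<longrightarrow> m < kap (j - 1))}" for j
  have setL: "{nu\<in>unit_moves (Suc n) lam. kap \<in> interlaced n nu} = PiE {1..Suc n} S" (is "?L = _")
  proof (intro equalityI subsetI)
    fix nu assume nu: "nu \<in> ?L"
    have "nu j \<in> S j" if j: "j \<in> {1..Suc n}" for j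
    proof -
      have "kap j \<le> nu j" if "j \<le> n" using nu j that by (auto simp: interlaced_def PiE_iff)
      moreover have "nu j < kap (j - 1)" if "2 \<le> j"
      proof -
        have "j - 1 \<in> {1..n}" "Suc (j - 1) = j" using that j by auto
        then show ?thesis using nu by (auto simp: interlaced_def PiE_iff dest!: bspec[of _ _ "j - 1"])
      qed
      ultimately show ?thesis using nu j by (auto simp: S_def unit_moves_def PiE_iff)
    qed
    then show "nu \<in> PiE {1..Suc n} S" using nu by (auto simp: unit_moves_def PiE_iff)
  next
    fix nu assume nu: "nu \<in> PiE {1..Suc n} S"
    have "nu (Suc j) < kap j \<and> kap j \<le> nu j" if "j \<in> {1..n}" for j
    proof -
      have "nu j \<in> S j" "nu (Suc j) \<in> S (Suc j)" using nu that by (auto simp: PiE_iff)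
      then show ?thesis using that by (auto simp: S_def)
    qed
    moreover have "nu j \<in> {lam j..lam j + 1}" if "j \<in> {1..Suc n}" for j
      using nu that by (auto simp: PiE_iff S_def)
    ultimately show "nu \<in> ?L" using nu ext by (auto simp: unit_moves_def interlaced_def PiE_iff)
  qed
  have fS: "finite (S j)" for j by (rule finite_subset[of _ "{lam j..lam j + 1}"]) (auto simp: S_def)
  have "(\<Sum>nu\<in>?L. u powi (rowsum (Suc n) nu - rowsum (Suc n) lam) * \<phi> (nu (Suc n)))
     = (\<Sum>nu\<in>PiE {1..Suc n} S. \<Prod>j\<in>{1..Suc n}. u powi (nu j - lam j) * (if j = Suc n then \<phi> (nu j) else 1))"
    unfolding setL using u
    by (intro sum.cong refl, subst powi_rowsum_diff, simp, simp) 
  also have "\<dots> = (\<Prod>j\<in>{1..Suc n}. \<Sum>m\<in>S j. u powi (m - lam j) * (if j = Suc n then \<phi> m else 1))"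
    by (subst prod_sum_PiE) (auto simp: fS)
  also have "\<dots> = (\<Prod>j\<in>{1..n}. \<Sum>m\<in>S j. u powi (m - lam j)) * (\<Sum>m\<in>S (Suc n). u powi (m - lam (Suc n)) * \<phi> m)"
    by simp
  also have "(\<Prod>j\<in>{1..n}. \<Sum>m\<in>S j. u powi (m - lam j)) = (\<Prod>j\<in>{1..n}. F j)"
  proof (intro prod.cong refl)
    fix j assume j: "j \<in> {1..n}"
    have *: "2 \<le> j \<Longrightarrow> lam j < kap (j - 1)" using win[of "j - 1"] j by auto
    show "(\<Sum>m\<in>S j. u powi (m - lam j)) = F j"
      unfolding S_def sum_over_two_points F_def A_def B_def using j win[of j] * by auto
  qed
  also have "(\<Sum>m\<in>S (Suc n). u powi (m - lam (Suc n)) * \<phi> m)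
      = \<phi> (lam (Suc n)) + u * of_bool (B n) * \<phi> (lam (Suc n) + 1)"
    unfolding S_def sum_over_two_points B_def using win[of n] by auto
  finally have L: "(\<Sum>nu\<in>?L. u powi (rowsum (Suc n) nu - rowsum (Suc n) lam) * \<phi> (nu (Suc n)))
     = (\<Prod>j\<in>{1..n}. F j) * (\<phi> (lam (Suc n)) + u * of_bool (B n) * \<phi> (lam (Suc n) + 1))" .
  define S' where "S' j = {m\<in>{kap j - 1..kap j - 1 + 1}. lam (Suc j) < m \<and> m \<le> lam j}" for j
  have fS': "finite (S' j)" for j by (rule finite_subset[of _ "{kap j - 1..kap j}"]) (auto simp: S'_def)
  have setR: "{mu\<in>interlaced n lam. kap \<in> unit_moves n mu} = PiE {1..n} S'"
  proof (intro equalityI subsetI)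
    fix mu assume mu: "mu \<in> {mu\<in>interlaced n lam. kap \<in> unit_moves n mu}"
    have "mu j \<in> S' j" if "j \<in> {1..n}" for j
    proof -
      have "mu j \<in> {lam (Suc j)<..lam j}" "kap j \<in> {mu j..mu j + 1}"
        using mu that by (simp_all add: unit_moves_def interlaced_def PiE_iff)
      then show ?thesis by (simp add: S'_def)
    qed
    then show "mu \<in> PiE {1..n} S'" using mu by (simp add: interlaced_def PiE_iff)
  next
    fix mu assume mu: "mu \<in> PiE {1..n} S'"
    have "mu j \<in> {lam (Suc j)<..lam j} \<and> kap j \<in> {mu j..mu j + 1}" if "j \<in> {1..n}" for j
    proof -
      have "mu j \<in> S' j" using mu that by (simp add: PiE_iff)
      then show ?thesis by (simp add: S'_def)
    qed
    then show "mu \<in> {mu\<in>interlaced n lam. kap \<in> unit_moves n mu}"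
      using mu ext by (simp add: unit_moves_def interlaced_def PiE_iff)
  qed
  have "(\<Sum>mu\<in>{mu\<in>interlaced n lam. kap \<in> unit_moves n mu}. u powi (rowsum n kap - rowsum n mu))
     = (\<Sum>mu\<in>PiE {1..n} S'. \<Prod>j\<in>{1..n}. u powi (kap j - mu j))"
    unfolding setR using u by (intro sum.cong refl, subst powi_rowsum_diff) auto
  also have "\<dots> = (\<Prod>j\<in>{1..n}. \<Sum>m\<in>S' j. u powi (kap j - m))"
    by (subst prod_sum_PiE) (auto simp: fS')
  also have "\<dots> = (\<Prod>j\<in>{1..n}. G j)"
  proof (intro prod.cong refl)
    fix j assume j: "j \<in> {1..n}"
    then show "(\<Sum>m\<in>S' j. u powi (kap j - m)) = G j"
      unfolding S'_def sum_over_two_points G_def A_def B_def using win[of j] by auto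
  qed
  finally have R: "(\<Sum>mu\<in>{mu\<in>interlaced n lam. kap \<in> unit_moves n mu}. u powi (rowsum n kap - rowsum n mu))
     = \<beta> n * (\<Prod>j\<in>{1..n}. F j)" using FG[of n] by simp
  have blocked: "blocked n kap (lam (Suc n)) = lam (Suc n)"
    "blocked n kap (lam (Suc n) + 1) = (if B n then lam (Suc n) + 1 else lam (Suc n))"
    using win[of n] by (auto simp: blocked_def B_def)
  have "1 + u \<noteq> 0" "\<phi> a + u * \<phi> a = (1 + u) * \<phi> a" for a
    using u by (linarith, simp add: distrib_right)
  then show ?thesis unfolding L R blocked by (auto simp: \<beta>_def)
qed

section \<open>Gelfand-Tsetlin sums and the intertwining with dTASEP\<close>

text \<open>
  States are functions on all of \<open>nat\<close>, and \<open>dtasep_step\<close> also moves the coordinates that stand for no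
  particle. Test functions have to ignore those.
\<close>

definition depends_on_first :: "nat \<Rightarrow> ((nat \<Rightarrow> int) \<Rightarrow> real) \<Rightarrow> bool" where
  "depends_on_first n f \<longleftrightarrow> (\<forall>z z'. (\<forall>k\<in>{1..n}. z k = z' k) \<longrightarrow> f z = f z')"

text \<open>
  The sum over all triangular patterns with top row \<open>x\<close> of length \<open>n\<close>, by recursion on the
  rows, of the weight times \<open>f\<close> at the diagonal. The last entry of each row is written into the argument
  of \<open>f\<close>, and the coordinates outside \<open>1..n\<close> of that argument are \<open>0\<close>.
  The identification with configurations is \<open>GT_sum_eq_sum_configs\<close>.
\<close>

fun GT_sum :: "(nat \<Rightarrow> real) \<Rightarrow> nat \<Rightarrow> ((nat \<Rightarrow> int) \<Rightarrow> real) \<Rightarrow> (nat \<Rightarrow> int) \<Rightarrow> real" where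
  "GT_sum q 0 f x = f (\<lambda>_. 0)"
| "GT_sum q (Suc n) f x = (\<Sum>v\<in>interlaced n x. q (Suc n) powi (rowsum (Suc n) x - rowsum n v)
      * GT_sum q n (\<lambda>z. f (z(Suc n := x (Suc n)))) v)"

text \<open>
  The transition operator of one dTASEP step, without normalization: \<open>w\<close> is the set of particles that
  attempt a jump, with weight \<open>u k\<close> for an attempt of particle \<open>k\<close> and \<open>1\<close> for none.
\<close>

definition step_operator :: "(nat \<Rightarrow> real) \<Rightarrow> nat \<Rightarrow> ((nat \<Rightarrow> int) \<Rightarrow> real) \<Rightarrow> (nat \<Rightarrow> int) \<Rightarrow> real" where
  "step_operator u n f z = (\<Sum>w\<in>Pow {1..n}. (\<Prod>k\<in>w. u k) * f (dtasep_step (\<lambda>k. k \<in> w) z))"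

lemma GT_sum_add_mult:
  "GT_sum q n (\<lambda>z. f z + c * g z) x = GT_sum q n f x + c * GT_sum q n g x"
  by (induction n arbitrary: f g x)
     (simp_all add: sum.distrib sum_distrib_left algebra_simps)

text \<open>
  Every pattern with top row \<open>x\<close> has \<open>x n\<close> as its last diagonal entry, so \<open>f\<close> is evaluated only where
  the coordinate \<open>n\<close> equals \<open>x n\<close>. This turns conditions on the diagonal into conditions on the row.
\<close>

lemma GT_sum_last_cong:
  assumes "n \<noteq> 0" "\<And>z. z n = x n \<Longrightarrow> f z = g z"
  shows "GT_sum q n f x = GT_sum q n g x"
  using assms by (cases n) simp_all

lemma GT_sum_eq_0:
  assumes "\<not> strictly_decr n x"
  shows "GT_sum q n f x = 0"
proof -
  obtain j where j: "1 \<le> j" "j < n" "\<not> x (Suc j) < x j" using assms by (auto simp: strictly_decr_def)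
  obtain m where m: "n = Suc m" using j by (cases n) auto
  have "interlaced m x = {}" unfolding interlaced_def using j m by (auto simp: PiE_eq_empty_iff)
  then show ?thesis by (simp add: m)
qed

lemma dtasep_step_cong:
  assumes "\<And>k. 1 \<le> k \<Longrightarrow> k \<le> n \<Longrightarrow> (w k \<longleftrightarrow> w' k) \<and> z k = z' k" "1 \<le> k" "k \<le> n"
  shows "dtasep_step w z k = dtasep_step w' z' k"
  using assms(2,3)
proof (induction k)
  case (Suc k)
  then show ?case using assms(1)[of "Suc k"] assms(1)[of 1] by (cases "k = 0") auto
qed simp

lemma dtasep_step_last:
  "dtasep_step w z (Suc n) = blocked n (dtasep_step w z) (z (Suc n) + of_bool (w (Suc n)))"
  by (simp add: blocked_def)

lemma sum_Pow_insert:
  fixes h :: "'a set \<Rightarrow> real"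
  assumes "finite A" "a \<notin> A"
  shows "(\<Sum>w\<in>Pow (insert a A). h w) = (\<Sum>w\<in>Pow A. h w + h (insert a w))"
proof -
  have "inj_on (insert a) (Pow A)" using assms by (auto simp: inj_on_def)
  moreover have "Pow A \<inter> insert a ` Pow A = {}" using assms by auto
  ultimately show ?thesis using assms
    by (simp add: Pow_insert sum.union_disjoint sum.reindex sum.distrib)
qed

text \<open>
  The update is sequential: the first \<open>n\<close> particles move without looking behind, and the next one reacts
  to their new positions. Peeling off the last particle therefore gives the operator for \<open>n\<close>
  particles applied to a test function that already averages over the last jump.
\<close>

lemma step_operator_Suc:
  assumes "depends_on_first (Suc n) f"
  shows "step_operator u (Suc n) f (z(Suc n := a)) =
    step_operator u n (\<lambda>z'. f (z'(Suc n := blocked n z' a)) + u (Suc n) * f (z'(Suc n := blocked n z' (a + 1)))) z"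
proof -
  have eq: "f (dtasep_step (\<lambda>k. k \<in> w') (z(Suc n := a)))
      = f ((dtasep_step (\<lambda>k. k \<in> w) z)(Suc n := blocked n (dtasep_step (\<lambda>k. k \<in> w) z) (a + of_bool (Suc n \<in> w'))))"
    if "w' = w \<or> w' = insert (Suc n) w" for w w'
  proof -
    have *: "dtasep_step (\<lambda>k. k \<in> w') (z(Suc n := a)) k = dtasep_step (\<lambda>k. k \<in> w) z k"
      if "1 \<le> k" "k \<le> n" for k
      using that \<open>w' = w \<or> w' = insert (Suc n) w\<close> by (intro dtasep_step_cong[of n]) auto
    have "blocked n (dtasep_step (\<lambda>k. k \<in> w') (z(Suc n := a))) = blocked n (dtasep_step (\<lambda>k. k \<in> w) z)"
      using *[of n] by (auto simp: blocked_def fun_eq_iff)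
    then have "dtasep_step (\<lambda>k. k \<in> w') (z(Suc n := a)) k =
       ((dtasep_step (\<lambda>k. k \<in> w) z)(Suc n := blocked n (dtasep_step (\<lambda>k. k \<in> w) z) (a + of_bool (Suc n \<in> w')))) k"
      if "1 \<le> k" "k \<le> Suc n" for k
      using that * dtasep_step_last[of "\<lambda>k. k \<in> w'" "z(Suc n := a)" n] by (cases "k = Suc n") auto
    then show ?thesis using assms unfolding depends_on_first_def by (metis atLeastAtMost_iff)
  qed
  have I: "{1..Suc n} = insert (Suc n) {1..n}" by auto
  show ?thesis
    unfolding step_operator_def I
    apply (subst sum_Pow_insert)
      apply (simp_all)
    apply (intro sum.cong refl)
    subgoal for w
      using finite_subset[of w "{Suc 0..n}"] eq[of w w] eq[of "insert (Suc n) w" w]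
      by (cases "Suc n \<in> w") (auto simp: algebra_simps)
    done
qed

lemma depends_on_first_step_operator:
  assumes "depends_on_first n f"
  shows "depends_on_first n (step_operator u n f)"
  unfolding depends_on_first_def
proof (intro allI impI)
  fix z z' :: "nat \<Rightarrow> int"
  assume z: "\<forall>k\<in>{1..n}. z k = z' k"
  have "f (dtasep_step (\<lambda>k. k \<in> w) z) = f (dtasep_step (\<lambda>k. k \<in> w) z')" for w
    using assms z dtasep_step_cong[of n _ _ z z'] unfolding depends_on_first_def
    by (metis atLeastAtMost_iff)
  then show "step_operator u n f z = step_operator u n f z'" by (simp add: step_operator_def)
qed

lemma strictly_decr_interlaced:
  assumes "v \<in> interlaced n x"
  shows "strictly_decr n v"
proof -
  have "v (Suc j) \<le> x (Suc j) \<and> x (Suc j) < v j" if "1 \<le> j" "j < n" for j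
  proof -
    have "v (Suc j) \<in> {x (Suc (Suc j))<..x (Suc j)}" "v j \<in> {x (Suc j)<..x j}"
      using assms that by (simp_all add: interlaced_def PiE_iff)
    then show ?thesis by simp
  qed
  then show ?thesis by (force simp: strictly_decr_def)
qed

text \<open>
  Jumps of all entries of the top row of a pattern, summed with weight \<open>p\<close> per jump, act on the diagonal
  as one dTASEP step with jump weights \<open>p * q k\<close>. In the induction the jump of the longer row is exchanged with
  the interlacing through \<open>row_exchange\<close>. A unit move in the longer row also raises the exponent of
  \<open>q (Suc n)\<close> by one, so the two combine to \<open>u = p * q (Suc n)\<close>; the last entry then follows the rule
  of particle \<open>Suc n\<close>, and the induction hypothesis handles the others.
\<close>

lemma intertwining:
  assumes p: "p > 0" and q: "\<And>j. 1 \<le> j \<Longrightarrow> j \<le> n \<Longrightarrow> q j > 0"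
    and "strictly_decr n lam" and "depends_on_first n f"
  shows "(\<Sum>nu\<in>unit_moves n lam. p powi (rowsum n nu - rowsum n lam) * GT_sum q n f nu)
       = GT_sum q n (step_operator (\<lambda>k. p * q k) n f) lam"
  using q assms(3,4)
proof (induction n arbitrary: lam f)
  case 0
  have "f (\<lambda>_. 0) = f (dtasep_step (\<lambda>_. False) (\<lambda>_. 0))"
    by (rule 0(3)[unfolded depends_on_first_def, rule_format]) simp
  then show ?case by (simp add: unit_moves_def step_operator_def)
next
  case (Suc n)
  define qn where "qn = q (Suc n)"
  define u where "u = p * qn"
  define l where "l = lam (Suc n)"
  define K where "K a kap = GT_sum q n (\<lambda>z. f (z(Suc n := a))) kap" for a kap
  define g where "g z = f (z(Suc n := blocked n z l)) + u * f (z(Suc n := blocked n z (l + 1)))" for z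
  \<comment> \<open>A box that contains every possible new shorter row, whether reached from \<open>mu\<close> by moving or found
    between the entries of a moved row \<open>nu\<close>; it allows the order of summation to be exchanged.\<close>
  define Wn where "Wn = PiE {1..n} (\<lambda>j. {lam (Suc j)<..lam j + 1})"
  have qn: "qn > 0" using Suc.prems(1) by (simp add: qn_def)
  have u: "u > 0" using p qn by (simp add: u_def)
  have finW: "finite Wn" by (auto simp: Wn_def intro!: finite_PiE)
  have f: "f z = f z'" if "\<And>k. 1 \<le> k \<Longrightarrow> k \<le> Suc n \<Longrightarrow> z k = z' k" for z z'
    using Suc.prems(3) that unfolding depends_on_first_def by (metis atLeastAtMost_iff)
  have "depends_on_first n g"
    unfolding depends_on_first_def
  proof (intro allI impI)
    fix z z' :: "nat \<Rightarrow> int" assume z: "\<forall>k\<in>{1..n}. z k = z' k"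
    have c: "blocked n z = blocked n z'" using z by (auto simp: blocked_def fun_eq_iff)
    have "f (z(Suc n := a)) = f (z'(Suc n := a))" for a using z by (intro f) auto
    then show "g z = g z'" unfolding g_def c by simp
  qed
  note IH = Suc.IH[OF Suc.prems(1) strictly_decr_interlaced this, simplified]
  have gK: "GT_sum q n g kap = K (blocked n kap l) kap + u * K (blocked n kap (l + 1)) kap" for kap
  proof (cases "n = 0")
    case True
    then show ?thesis by (simp add: g_def K_def blocked_def)
  next
    case False
    then have "GT_sum q n g kap = GT_sum q n (\<lambda>z. f (z(Suc n := blocked n kap l)) + u * f (z(Suc n := blocked n kap (l + 1)))) kap"
      by (intro GT_sum_last_cong) (simp_all add: g_def blocked_def)
    then show ?thesis by (simp add: GT_sum_add_mult K_def)
  qed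
  have b1: "interlaced n nu = {kap\<in>Wn. kap \<in> interlaced n nu}" if nu: "nu \<in> unit_moves (Suc n) lam" for nu
  proof -
    have b: "lam j \<le> nu j \<and> nu j \<le> lam j + 1" if "1 \<le> j" "j \<le> Suc n" for j
      using nu that by (auto simp: unit_moves_def PiE_iff)
    have "kap \<in> Wn" if k: "kap \<in> interlaced n nu" for kap
    proof -
      have "kap j \<in> {lam (Suc j)<..lam j + 1}" if "j \<in> {1..n}" for j
        using b[of j] b[of "Suc j"] that k by (force simp: interlaced_def PiE_iff)
      then show ?thesis using k by (simp add: Wn_def interlaced_def PiE_iff)
    qed
    then show ?thesis by auto
  qed
  have b2: "unit_moves n mu = {kap\<in>Wn. kap \<in> unit_moves n mu}" if mu: "mu \<in> interlaced n lam" for mu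
  proof -
    have b: "lam (Suc j) < mu j \<and> mu j \<le> lam j" if "1 \<le> j" "j \<le> n" for j
      using mu that by (auto simp: interlaced_def PiE_iff)
    have "kap \<in> Wn" if k: "kap \<in> unit_moves n mu" for kap
    proof -
      have "kap j \<in> {lam (Suc j)<..lam j + 1}" if "j \<in> {1..n}" for j
        using b[of j] that k by (force simp: unit_moves_def PiE_iff)
      then show ?thesis using k by (simp add: Wn_def unit_moves_def PiE_iff)
    qed
    then show ?thesis by auto
  qed
  have "(\<Sum>nu\<in>unit_moves (Suc n) lam. p powi (rowsum (Suc n) nu - rowsum (Suc n) lam) * GT_sum q (Suc n) f nu)
     = (\<Sum>nu\<in>unit_moves (Suc n) lam. \<Sum>kap\<in>{kap\<in>Wn. kap \<in> interlaced n nu}. p powi (rowsum (Suc n) nu - rowsum (Suc n) lam) *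
          (qn powi (rowsum (Suc n) nu - rowsum n kap) * K (nu (Suc n)) kap))"
    by (intro sum.cong refl) (subst b1[symmetric], simp, simp add: sum_distrib_left K_def qn_def)
  also have "\<dots> = (\<Sum>kap\<in>Wn. \<Sum>nu\<in>{nu\<in>unit_moves (Suc n) lam. kap \<in> interlaced n nu}. p powi (rowsum (Suc n) nu - rowsum (Suc n) lam) *
          (qn powi (rowsum (Suc n) nu - rowsum n kap) * K (nu (Suc n)) kap))"
    by (rule sum.swap_restrict) (use finW in auto)
  also have "\<dots> = (\<Sum>kap\<in>Wn. \<Sum>mu\<in>{mu\<in>interlaced n lam. kap \<in> unit_moves n mu}. qn powi (rowsum (Suc n) lam - rowsum n mu) *
          (p powi (rowsum n kap - rowsum n mu) * GT_sum q n g kap))"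
  proof (rule sum.cong[OF refl])
    fix kap assume kap: "kap \<in> Wn"
    show "(\<Sum>nu\<in>{nu\<in>unit_moves (Suc n) lam. kap \<in> interlaced n nu}. p powi (rowsum (Suc n) nu - rowsum (Suc n) lam) *
          (qn powi (rowsum (Suc n) nu - rowsum n kap) * K (nu (Suc n)) kap))
        = (\<Sum>mu\<in>{mu\<in>interlaced n lam. kap \<in> unit_moves n mu}. qn powi (rowsum (Suc n) lam - rowsum n mu) *
          (p powi (rowsum n kap - rowsum n mu) * GT_sum q n g kap))"
    proof (cases "strictly_decr n kap")
      case False
      then show ?thesis by (simp add: gK K_def GT_sum_eq_0)
    next
      case True
      have e1: "p powi (a - b) * (qn powi (a - c) * d) = qn powi (b - c) * (u powi (a - b) * d)" for a b c d
      proof -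
        have "qn powi (a - c) = qn powi (b - c) * qn powi (a - b)"
          using qn by (subst power_int_add[symmetric]) auto
        then show ?thesis by (simp add: u_def power_int_mult_distrib)
      qed
      have e2: "qn powi (a - b) * (p powi (c - b) * d) = qn powi (a - c) * (u powi (c - b) * d)" for a b c d
      proof -
        have "qn powi (a - b) = qn powi (a - c) * qn powi (c - b)"
          using qn by (subst power_int_add[symmetric]) auto
        then show ?thesis by (simp add: u_def power_int_mult_distrib)
      qed
      have "(\<Sum>nu\<in>{nu\<in>unit_moves (Suc n) lam. kap \<in> interlaced n nu}. u powi (rowsum (Suc n) nu - rowsum (Suc n) lam) * K (nu (Suc n)) kap)
        = (\<Sum>mu\<in>{mu\<in>interlaced n lam. kap \<in> unit_moves n mu}. u powi (rowsum n kap - rowsum n mu)) *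
            (K (blocked n kap (lam (Suc n))) kap + u * K (blocked n kap (lam (Suc n) + 1)) kap)"
        using kap Suc.prems(2) by (intro row_exchange[OF u _ True]) (auto simp: Wn_def PiE_iff)
      then show ?thesis
        unfolding e1 e2 gK l_def sum_distrib_left[symmetric] sum_distrib_right[symmetric] by simp
    qed
  qed
  also have "\<dots> = (\<Sum>mu\<in>interlaced n lam. \<Sum>kap\<in>{kap\<in>Wn. kap \<in> unit_moves n mu}. qn powi (rowsum (Suc n) lam - rowsum n mu) *
          (p powi (rowsum n kap - rowsum n mu) * GT_sum q n g kap))"
    by (rule sum.swap_restrict[symmetric]) (use finW in auto)
  also have "\<dots> = (\<Sum>mu\<in>interlaced n lam. qn powi (rowsum (Suc n) lam - rowsum n mu) *
        GT_sum q n (step_operator (\<lambda>k. p * q k) n g) mu)"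
    by (intro sum.cong refl, subst b2[symmetric], assumption, subst IH[symmetric], simp, simp add: sum_distrib_left)
  also have "step_operator (\<lambda>k. p * q k) n g = (\<lambda>z. step_operator (\<lambda>k. p * q k) (Suc n) f (z(Suc n := l)))"
    unfolding step_operator_Suc[OF Suc.prems(3)] g_def u_def qn_def by simp
  finally show ?case by (simp add: qn_def l_def)
qed

section \<open>Determinants with indices starting at 1\<close>

lemma det1_cong:
  assumes "\<And>i j. 1 \<le> i \<Longrightarrow> i \<le> n \<Longrightarrow> 1 \<le> j \<Longrightarrow> j \<le> n \<Longrightarrow> f i j = g i j"
  shows "det1 n f = det1 n g"
proof -
  have "Matrix.mat n n (\<lambda>(i, j). f (Suc i) (Suc j)) = Matrix.mat n n (\<lambda>(i, j). g (Suc i) (Suc j))"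
    using assms by (intro eq_matI) auto
  then show ?thesis by (simp add: det1_def)
qed

text \<open>
  Permutations act on \<open>0..<n\<close>, hence the shifts by one.
\<close>

lemma det1_leibniz:
  "det1 n f = (\<Sum>\<pi> | \<pi> permutes {0..<n}. signof \<pi> * (\<Prod>j\<in>{1..n}. f (Suc (\<pi> (j - 1))) j))"
proof -
  have "det1 n f = (\<Sum>\<pi> | \<pi> permutes {0..<n}. signof \<pi> *
      (\<Prod>j<n. Matrix.mat n n (\<lambda>(i, j). f (Suc i) (Suc j)) $$ (\<pi> j, j)))"
    unfolding det1_def by (rule det_col) simp
  also have "\<dots> = (\<Sum>\<pi> | \<pi> permutes {0..<n}. signof \<pi> * (\<Prod>j\<in>{1..n}. f (Suc (\<pi> (j - 1))) j))"
  proof (rule sum.cong[OF refl])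
    fix \<pi> assume "\<pi> \<in> {\<pi>. \<pi> permutes {0..<n}}"
    then have "\<pi> j < n" if "j < n" for j using that permutes_in_image[of \<pi> "{0..<n}" j] by simp
    then show "signof \<pi> * (\<Prod>j<n. Matrix.mat n n (\<lambda>(i, j). f (Suc i) (Suc j)) $$ (\<pi> j, j))
        = (signof \<pi> * (\<Prod>j\<in>{1..n}. f (Suc (\<pi> (j - 1))) j) :: real)"
      by (simp add: prod.atLeast1_atMost_eq)
  qed
  finally show ?thesis .
qed

text \<open>
  Used in two ways: to expand a convolution in time, and to sum every column over a range of its own.
\<close>

lemma det1_multilinear:
  assumes "\<And>j. j \<in> {1..n} \<Longrightarrow> finite (A j)"
  shows "det1 n (\<lambda>i j. \<Sum>a\<in>A j. c j a * F i a)
       = (\<Sum>g\<in>PiE {1..n} A. (\<Prod>j\<in>{1..n}. c j (g j)) * det1 n (\<lambda>i j. F i (g j)))"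
proof -
  have *: "(\<Prod>j\<in>{1..n}. \<Sum>a\<in>A j. G j a) = (\<Sum>g\<in>PiE {1..n} A. \<Prod>j\<in>{1..n}. G j (g j))"
    for G :: "nat \<Rightarrow> 'a \<Rightarrow> real" using assms by (intro prod_sum_PiE) auto
  have "det1 n (\<lambda>i j. \<Sum>a\<in>A j. c j a * F i a)
      = (\<Sum>\<pi> | \<pi> permutes {0..<n}. \<Sum>g\<in>PiE {1..n} A.
           signof \<pi> * ((\<Prod>j\<in>{1..n}. c j (g j)) * (\<Prod>j\<in>{1..n}. F (Suc (\<pi> (j - 1))) (g j))))"
    unfolding det1_leibniz * prod.distrib sum_distrib_left ..
  also have "\<dots> = (\<Sum>g\<in>PiE {1..n} A. (\<Prod>j\<in>{1..n}. c j (g j)) * det1 n (\<lambda>i j. F i (g j)))"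
    unfolding det1_leibniz by (subst sum.swap) (simp add: sum_distrib_left mult.left_commute)
  finally show ?thesis .
qed

lemma det1_zero_col:
  assumes "1 \<le> j" "j \<le> n" "\<And>i. 1 \<le> i \<Longrightarrow> i \<le> n \<Longrightarrow> f i j = 0"
  shows "det1 n f = 0"
  unfolding det1_leibniz
proof (intro sum.neutral ballI)
  fix \<pi> assume "\<pi> \<in> {\<pi>. \<pi> permutes {0..<n}}"
  then have "\<pi> (j - 1) < n" using assms(1,2) permutes_in_image[of \<pi> "{0..<n}" "j - 1"] by simp
  then have "(\<Prod>j\<in>{1..n}. f (Suc (\<pi> (j - 1))) j) = 0"
    using assms by (intro prod_zero bexI[of _ j]) auto
  then show "signof \<pi> * (\<Prod>j\<in>{1..n}. f (Suc (\<pi> (j - 1))) j) = 0" by simp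
qed

lemma det1_equal_cols:
  assumes "1 \<le> a" "a < b" "b \<le> n" "\<And>i. 1 \<le> i \<Longrightarrow> i \<le> n \<Longrightarrow> f i a = f i b"
  shows "det1 n f = 0"
  unfolding det1_def
proof (rule det_identical_columns[of _ n "a - 1" "b - 1"])
  show "col (Matrix.mat n n (\<lambda>(i, j). f (Suc i) (Suc j))) (a - 1)
      = col (Matrix.mat n n (\<lambda>(i, j). f (Suc i) (Suc j))) (b - 1)"
    using assms by (intro eq_vecI) auto
qed (use assms in auto)

lemma det1_lower_triangular:
  assumes "\<And>i j. 1 \<le> i \<Longrightarrow> i < j \<Longrightarrow> j \<le> n \<Longrightarrow> f i j = 0"
  shows "det1 n f = (\<Prod>j\<in>{1..n}. f j j)"
proof -
  have "det1 n f = prod_list (diag_mat (Matrix.mat n n (\<lambda>(i, j). f (Suc i) (Suc j))))"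
    unfolding det1_def using assms by (intro det_lower_triangular[where n = n]) auto
  then show ?thesis by (simp add: prod_list_diag_prod prod.atLeast1_atMost_eq atLeast0LessThan)
qed

lemma det1_last_row:
  assumes "\<And>j. 1 \<le> j \<Longrightarrow> j \<le> n \<Longrightarrow> f (Suc n) j = 0"
  shows "det1 (Suc n) f = f (Suc n) (Suc n) * det1 n f"
proof -
  define A where "A = Matrix.mat (Suc n) (Suc n) (\<lambda>(i, j). f (Suc i) (Suc j))"
  have "det A = (\<Sum>j<Suc n. A $$ (n, j) * cofactor A n j)"
    by (rule laplace_expansion_row) (auto simp: A_def)
  also have "\<dots> = A $$ (n, n) * cofactor A n n"
    using assms by (simp add: A_def)
  also have "mat_delete A n n = Matrix.mat n n (\<lambda>(i, j). f (Suc i) (Suc j))"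
    unfolding mat_delete_def A_def by (intro eq_matI) auto
  then have "cofactor A n n = det1 n f" by (simp add: cofactor_def det1_def)
  finally show ?thesis by (simp add: A_def det1_def)
qed

text \<open>
  The operation is multiplication from the right by an upper bidiagonal matrix with unit diagonal.
\<close>

lemma det1_subtract_previous_col:
  "det1 n (\<lambda>i j. f i j - (if j = 1 then 0 else s j * f i (j - 1))) = det1 n f"
proof -
  define A where "A = Matrix.mat n n (\<lambda>(i, j). f (Suc i) (Suc j))"
  define U where "U = Matrix.mat n n (\<lambda>(k, j). if k = j then 1 else if Suc k = j then - s (Suc j) else 0)"
  have "Matrix.mat n n (\<lambda>(i, j). f (Suc i) (Suc j) - (if Suc j = 1 then 0 else s (Suc j) * f (Suc i) (Suc j - 1)))
      = A * U"
  proof (rule eq_matI)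
    fix i j assume ij: "i < dim_row (A * U)" "j < dim_col (A * U)"
    then have "(A * U) $$ (i, j) = (\<Sum>k<n. f (Suc i) (Suc k) * (if k = j then 1 else if Suc k = j then - s (Suc j) else 0))"
      by (simp add: A_def U_def scalar_prod_def atLeast0LessThan)
    also have "\<dots> = (\<Sum>k<n. (if k = j then f (Suc i) (Suc k) else 0) + (if Suc k = j then - s (Suc j) * f (Suc i) (Suc k) else 0))"
      by (intro sum.cong) auto
    also have "\<dots> = f (Suc i) (Suc j) + (\<Sum>k<n. if Suc k = j then - s (Suc j) * f (Suc i) (Suc k) else 0)"
      using ij by (simp add: sum.distrib U_def)
    also have "(\<Sum>k<n. if Suc k = j then - s (Suc j) * f (Suc i) (Suc k) else 0)
        = - (if Suc j = 1 then 0 else s (Suc j) * f (Suc i) (Suc j - 1))"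
      using ij by (cases j) (simp_all add: U_def)
    finally show "Matrix.mat n n (\<lambda>(i, j). f (Suc i) (Suc j) - (if Suc j = 1 then 0 else s (Suc j) * f (Suc i) (Suc j - 1))) $$ (i, j)
        = (A * U) $$ (i, j)" using ij by (simp add: A_def U_def)
  qed (simp_all add: A_def U_def)
  moreover have "det (A * U) = det A * det U" by (rule det_mult[of _ n]) (auto simp: A_def U_def)
  moreover have "det U = prod_list (diag_mat U)"
    by (rule det_upper_triangular[of _ n]) (auto simp: U_def)
  moreover have "prod_list (diag_mat U) = 1" by (simp add: prod_list_diag_prod U_def)
  ultimately show ?thesis by (simp add: det1_def A_def)
qed

section \<open>Transport of one time step from the top row to the diagonal\<close>

definition row_box :: "nat \<Rightarrow> int \<Rightarrow> int \<Rightarrow> (nat \<Rightarrow> int) set" where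
  "row_box n L U = PiE {1..n} (\<lambda>_. {L..U})"

lemma finite_row_box [simp]: "finite (row_box n L U)"
  unfolding row_box_def by (auto intro!: finite_PiE)

lemma strictly_decr_less:
  assumes "strictly_decr n x" "1 \<le> i" "i < j" "j \<le> n"
  shows "x j < x i"
  using assms(3,4)
proof (induction j)
  case (Suc j)
  have "x (Suc j) < x j" using assms Suc.prems by (auto simp: strictly_decr_def)
  then show ?case using Suc by (cases "i = j") auto
qed simp

text \<open>
  A column of the new functions at \<open>x j\<close> mixes the columns of the old ones at \<open>x j\<close> and \<open>x j - 1\<close>.
\<close>

lemma det1_convolution:
  fixes p :: real
  assumes "p > 0" and h': "\<And>i x. 1 \<le> i \<Longrightarrow> i \<le> n \<Longrightarrow> h' i x = h i x + p * h i (x - 1)"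
  shows "det1 n (\<lambda>i j. h' i (x j))
       = (\<Sum>x'\<in>PiE {1..n} (\<lambda>j. {x j - 1..x j}). p powi (rowsum n x - rowsum n x') * det1 n (\<lambda>i j. h i (x' j)))"
proof -
  have two: "{a - 1..a} = {a - 1, a}" for a :: int by auto
  have "det1 n (\<lambda>i j. h' i (x j)) = det1 n (\<lambda>i j. \<Sum>a\<in>{x j - 1..x j}. p powi (x j - a) * h i a)"
    by (rule det1_cong) (simp add: h' two)
  also have "\<dots> = (\<Sum>x'\<in>PiE {1..n} (\<lambda>j. {x j - 1..x j}). (\<Prod>j\<in>{1..n}. p powi (x j - x' j)) * det1 n (\<lambda>i j. h i (x' j)))"
    by (rule det1_multilinear) simp
  also have "\<dots> = (\<Sum>x'\<in>PiE {1..n} (\<lambda>j. {x j - 1..x j}). p powi (rowsum n x - rowsum n x') * det1 n (\<lambda>i j. h i (x' j)))"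
    using assms(1) by (subst powi_rowsum_diff) auto
  finally show ?thesis .
qed

text \<open>
  After expanding the determinant, the roles are swapped: for each old row \<open>x'\<close> one sums over the new rows
  \<open>x\<close> that it can move to, and \<open>intertwining\<close> applies when \<open>x'\<close> is strictly decreasing. For the other
  old rows both sides vanish. Unless \<open>x'\<close> has two equal entries, which kills the determinant, no move
  of \<open>x'\<close> is strictly decreasing, and only strictly decreasing rows are top rows of patterns.
\<close>

lemma time_step:
  fixes p :: real
  assumes p: "p > 0" and q: "\<And>j. 1 \<le> j \<Longrightarrow> j \<le> n \<Longrightarrow> q j > 0"
    and h': "\<And>i x. 1 \<le> i \<Longrightarrow> i \<le> n \<Longrightarrow> h' i x = h i x + p * h i (x - 1)"
    and supp: "\<And>i x. 1 \<le> i \<Longrightarrow> i \<le> n \<Longrightarrow> h i x \<noteq> 0 \<Longrightarrow> L \<le> x \<and> x \<le> U"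
    and f: "depends_on_first n f"
  shows "(\<Sum>x\<in>row_box n L (U + 1). GT_sum q n f x * det1 n (\<lambda>i j. h' i (x j)))
       = (\<Sum>x\<in>row_box n L U. GT_sum q n (step_operator (\<lambda>k. p * q k) n f) x * det1 n (\<lambda>i j. h i (x j)))"
proof -
  define D where "D x = det1 n (\<lambda>i j. h i (x j))" for x
  have D0: "L \<le> x j \<and> x j \<le> U" if "D x \<noteq> 0" "1 \<le> j" "j \<le> n" for x j
    using det1_zero_col[of j n "\<lambda>i j. h i (x j)"] supp that unfolding D_def by blast
  have moved_row_in_box: "x \<in> row_box n L (U + 1)" if x: "x \<in> unit_moves n x'" and x': "x' \<in> row_box n L U" for x x'
  proof -
    have "x j \<in> {L..U + 1}" if "j \<in> {1..n}" for j
    proof -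
      have "x j \<in> {x' j..x' j + 1}" "x' j \<in> {L..U}"
        using x x' that by (simp_all add: unit_moves_def row_box_def PiE_iff)
      then show ?thesis by auto
    qed
    then show ?thesis using x by (simp add: unit_moves_def row_box_def PiE_iff)
  qed
  have conv: "det1 n (\<lambda>i j. h' i (x j))
       = (\<Sum>x'\<in>PiE {1..n} (\<lambda>j. {x j - 1..x j}). p powi (rowsum n x - rowsum n x') * D x')" for x
    unfolding D_def by (rule det1_convolution[OF p]) (rule h')
  have down: "det1 n (\<lambda>i j. h' i (x j))
       = (\<Sum>x'\<in>{x'\<in>row_box n L U. x \<in> unit_moves n x'}. p powi (rowsum n x - rowsum n x') * D x')"
    if x: "x \<in> row_box n L (U + 1)" for x
    unfolding conv
  proof (rule sum.mono_neutral_right)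
    have xe: "x \<in> extensional {1..n}" using x by (simp add: row_box_def PiE_iff)
    show "finite (PiE {1..n} (\<lambda>j. {x j - 1..x j}))" by (auto intro!: finite_PiE)
    have eq: "x' \<in> PiE {1..n} (\<lambda>j. {x j - 1..x j}) \<longleftrightarrow> x' \<in> extensional {1..n} \<and> x \<in> unit_moves n x'" for x'
    proof -
      have "x' j \<in> {x j - 1..x j} \<longleftrightarrow> x j \<in> {x' j..x' j + 1}" for j by auto
      then show ?thesis using xe by (auto simp: unit_moves_def PiE_iff)
    qed
    show "{x' \<in> row_box n L U. x \<in> unit_moves n x'} \<subseteq> PiE {1..n} (\<lambda>j. {x j - 1..x j})"
      unfolding subset_iff eq by (simp add: row_box_def PiE_iff)
    show "\<forall>x'\<in>PiE {1..n} (\<lambda>j. {x j - 1..x j}) - {x' \<in> row_box n L U. x \<in> unit_moves n x'}.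
        p powi (rowsum n x - rowsum n x') * D x' = 0"
    proof
      fix x' assume "x' \<in> PiE {1..n} (\<lambda>j. {x j - 1..x j}) - {x' \<in> row_box n L U. x \<in> unit_moves n x'}"
      then have "x' \<in> extensional {1..n}" "x' \<notin> row_box n L U" unfolding Diff_iff eq by auto
      then have "D x' = 0" using D0[of x'] by (cases "D x' = 0") (auto simp: row_box_def PiE_iff)
      then show "p powi (rowsum n x - rowsum n x') * D x' = 0" by simp
    qed
  qed
  have "(\<Sum>x\<in>row_box n L (U + 1). GT_sum q n f x * det1 n (\<lambda>i j. h' i (x j)))
     = (\<Sum>x\<in>row_box n L (U + 1). \<Sum>x'\<in>{x'\<in>row_box n L U. x \<in> unit_moves n x'}. GT_sum q n f x * (p powi (rowsum n x - rowsum n x') * D x'))"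
    by (rule sum.cong[OF refl]) (simp add: down sum_distrib_left)
  also have "\<dots> = (\<Sum>x'\<in>row_box n L U. \<Sum>x\<in>{x\<in>row_box n L (U + 1). x \<in> unit_moves n x'}. GT_sum q n f x * (p powi (rowsum n x - rowsum n x') * D x'))"
    by (rule sum.swap_restrict) simp_all
  also have "\<dots> = (\<Sum>x'\<in>row_box n L U. (\<Sum>x\<in>unit_moves n x'. p powi (rowsum n x - rowsum n x') * GT_sum q n f x) * D x')"
  proof (rule sum.cong[OF refl])
    fix x' assume "x' \<in> row_box n L U"
    then have "{x\<in>row_box n L (U + 1). x \<in> unit_moves n x'} = unit_moves n x'" using moved_row_in_box by auto
    then show "(\<Sum>x\<in>{x\<in>row_box n L (U + 1). x \<in> unit_moves n x'}. GT_sum q n f x * (p powi (rowsum n x - rowsum n x') * D x'))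
        = (\<Sum>x\<in>unit_moves n x'. p powi (rowsum n x - rowsum n x') * GT_sum q n f x) * D x'"
      by (simp add: sum_distrib_left sum_distrib_right ac_simps)
  qed
  also have "\<dots> = (\<Sum>x'\<in>row_box n L U. GT_sum q n (step_operator (\<lambda>k. p * q k) n f) x' * D x')"
  proof (rule sum.cong[OF refl])
    fix x'
    consider "D x' = 0" | "strictly_decr n x'" | "D x' \<noteq> 0" "\<not> strictly_decr n x'" by blast
    then show "(\<Sum>x\<in>unit_moves n x'. p powi (rowsum n x - rowsum n x') * GT_sum q n f x) * D x'
        = GT_sum q n (step_operator (\<lambda>k. p * q k) n f) x' * D x'"
    proof cases
      case 2
      then show ?thesis using intertwining[OF p q 2 f] by simp
    next
      case 3
      have "GT_sum q n f x = 0" if x: "x \<in> unit_moves n x'" for x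
      proof (rule GT_sum_eq_0, rule notI)
        assume d: "strictly_decr n x"
        have "x' (Suc j) < x' j" if j: "1 \<le> j" "j < n" for j
        proof -
          have "x j \<in> {x' j..x' j + 1}" "x (Suc j) \<in> {x' (Suc j)..x' (Suc j) + 1}"
            using x j by (simp_all add: unit_moves_def PiE_iff)
          moreover have "x (Suc j) < x j" using d j by (simp add: strictly_decr_def)
          moreover have "x' (Suc j) \<noteq> x' j"
          proof
            assume "x' (Suc j) = x' j"
            then have "D x' = 0" unfolding D_def using j by (intro det1_equal_cols[of j "Suc j"]) auto
            then show False using 3 by simp
          qed
          ultimately show ?thesis by auto
        qed
        then show False using 3 by (simp add: strictly_decr_def)
      qed
      then show ?thesis using 3 by (simp add: GT_sum_eq_0)
    qed simp
  qed
  finally show ?thesis by (simp add: D_def)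
qed

section \<open>The determinant at the initial time\<close>

text \<open>
  The values of the signed functions \<open>Psi\<close> before any jump, by recursion on the number of particles:
  the composition with one more kernel \<open>Qinv\<close> is a weighted difference, and the function with the
  largest index is a point mass at the start of the last particle.
\<close>

fun initial_Psi :: "(nat \<Rightarrow> real) \<Rightarrow> (nat \<Rightarrow> int) \<Rightarrow> nat \<Rightarrow> nat \<Rightarrow> int \<Rightarrow> real" where
  "initial_Psi q y 0 i x = 0"
| "initial_Psi q y (Suc n) i x = (if i = Suc n then of_bool (x = y (Suc n) - int (Suc n))
     else initial_Psi q y n i x - q (Suc n) * initial_Psi q y n i (x + 1))"

lemma initial_Psi_support:
  assumes "1 \<le> i" "i \<le> n" "initial_Psi q y n i x \<noteq> 0"
  shows "y i - int n \<le> x \<and> x \<le> y i - int i"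
  using assms
proof (induction n arbitrary: x)
  case (Suc n)
  show ?case
  proof (cases "i = Suc n")
    case False
    then have "initial_Psi q y n i x \<noteq> 0 \<or> initial_Psi q y n i (x + 1) \<noteq> 0" using Suc.prems by auto
    then show ?thesis using Suc.IH[of x] Suc.IH[of "x + 1"] Suc.prems False by auto
  qed (use Suc.prems in auto)
qed simp

lemma sum_telescope_int:
  fixes \<phi> :: "int \<Rightarrow> real"
  assumes "a \<le> b"
  shows "(\<Sum>m\<in>{a..<b}. \<phi> m - \<phi> (m + 1)) = \<phi> a - \<phi> b"
  using assms
proof (induction b rule: int_ge_induct)
  case (step b)
  then have "{a..<b + 1} = insert b {a..<b}" by auto
  then show ?case using step by simp
qed simp

lemma weyl_chamber_antimono:
  assumes "y \<in> weyl_chamber n" "1 \<le> i" "i \<le> j" "j \<le> n"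
  shows "y j \<le> y i"
  using assms(3,4)
proof (induction j)
  case (Suc j)
  show ?case
  proof (cases "i = Suc j")
    case False
    then have "y (Suc j) \<le> y j" using assms(1,2) Suc.prems by (auto simp: weyl_chamber_def)
    then show ?thesis using Suc False by auto
  qed simp
qed (use assms in simp)

lemma GT_sum_zero [simp]: "GT_sum q n (\<lambda>_. 0) x = 0"
  by (induction n arbitrary: x) simp_all

text \<open>
  The initial positions, set to \<open>0\<close> outside \<open>1..n\<close> as \<open>GT_sum\<close> expects.
\<close>

definition start_position :: "nat \<Rightarrow> (nat \<Rightarrow> int) \<Rightarrow> nat \<Rightarrow> int" where
  "start_position n y k = (if 1 \<le> k \<and> k \<le> n then y k - int k else 0)"

text \<open>
  Let \<open>c\<close> be the start of the last particle. By the support of the functions and the order of the starting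
  points, a strictly decreasing row contributes only if its last entry is \<open>c\<close>, and the determinant then reduces to
  its first \<open>n\<close> rows and columns. With the next shorter row \<open>v\<close> fixed, the other entries \<open>x j\<close>
  range independently over the gaps of \<open>v\<close>, the first one up to \<open>U\<close>. The powers of \<open>q (Suc n)\<close> turn the
  weighted differences defining the functions into telescoping ones, so each column becomes a
  difference of two columns belonging to consecutive entries of \<open>v\<close>; column operations
  remove the second of them. What remains is the statement for \<open>n\<close> particles, restricted to \<open>c < v n\<close>;
  this restriction goes into the test function, and the starting position of particle \<open>n\<close> satisfies it.
\<close>

lemma initial_condition:
  assumes "y \<in> weyl_chamber n" and "\<And>k. 1 \<le> k \<Longrightarrow> k \<le> n \<Longrightarrow> q k > 0"
    and "\<And>k. 1 \<le> k \<Longrightarrow> k \<le> n \<Longrightarrow> L \<le> y k - int n \<and> y k - int k \<le> U"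
  shows "(\<Sum>x\<in>row_box n L U. GT_sum q n f x * det1 n (\<lambda>i j. initial_Psi q y n i (x j)))
           * (\<Prod>k\<in>{1..n}. q k powi (int k - y k)) = f (start_position n y)"
  using assms
proof (induction n arbitrary: f)
  case 0
  have "start_position 0 y = (\<lambda>_. 0)" by (simp add: start_position_def fun_eq_iff)
  then show ?case by (simp add: row_box_def det1_leibniz sign_id)
next
  case (Suc n)
  define Q where "Q = q (Suc n)"
  define c where "c = y (Suc n) - int (Suc n)"
  define H where "H = initial_Psi q y n"
  define H' where "H' = initial_Psi q y (Suc n)"
  define K where "K v = GT_sum q n (\<lambda>z. f (z(Suc n := c))) v" for v
  have Q: "Q > 0" using Suc.prems(2)[of "Suc n"] by (simp add: Q_def)
  have weyl: "y \<in> weyl_chamber n" using Suc.prems(1) by (auto simp: weyl_chamber_def)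
  have c: "L \<le> c" "c \<le> U" using Suc.prems(3)[of "Suc n"] by (auto simp: c_def)
  have H'_last: "H' (Suc n) m = of_bool (m = c)" for m by (simp add: H'_def c_def)
  have H': "H' i m = H i m - Q * H i (m + 1)" if "i \<le> n" for i m
    using that by (simp add: H'_def H_def Q_def)
  have H'_low: "H' i m = 0" if "1 \<le> i" "i \<le> Suc n" "m < c" for i m
  proof (rule ccontr)
    assume "H' i m \<noteq> 0"
    then have "y i - int (Suc n) \<le> m"
      using initial_Psi_support[of i "Suc n" q y m] that unfolding H'_def by blast
    moreover have "y (Suc n) \<le> y i"
      using weyl_chamber_antimono[OF Suc.prems(1), of i "Suc n"] that by simp
    ultimately show False using that by (simp add: c_def)
  qed
  have detH': "det1 (Suc n) (\<lambda>i j. H' i (x j)) = of_bool (x (Suc n) = c) * det1 n (\<lambda>i j. H' i (x j))"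
    if x: "strictly_decr (Suc n) x" for x
  proof (cases "x (Suc n) < c")
    case True
    then have "det1 (Suc n) (\<lambda>i j. H' i (x j)) = 0"
      using H'_low by (intro det1_zero_col[of "Suc n"]) auto
    then show ?thesis using True by simp
  next
    case False
    have "H' (Suc n) (x j) = 0" if "1 \<le> j" "j \<le> n" for j
      using strictly_decr_less[OF x, of j "Suc n"] that False by (simp add: H'_last)
    then show ?thesis by (subst det1_last_row) (simp_all add: H'_last)
  qed
  have sub: "interlaced n x = {v\<in>row_box n L U. v \<in> interlaced n x}" if x: "x \<in> row_box (Suc n) L U" for x
  proof -
    have "v \<in> row_box n L U" if v: "v \<in> interlaced n x" for v
    proof -
      have "v j \<in> {L..U}" if j: "j \<in> {1..n}" for j
      proof -
        have "v j \<in> {x (Suc j)<..x j}" "x j \<in> {L..U}" "x (Suc j) \<in> {L..U}"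
          using v x j by (simp_all add: interlaced_def row_box_def PiE_iff)
        then show ?thesis by auto
      qed
      then show ?thesis using v by (simp add: row_box_def interlaced_def PiE_iff)
    qed
    then show ?thesis by auto
  qed
  have summand: "GT_sum q (Suc n) f x * det1 (Suc n) (\<lambda>i j. H' i (x j))
     = (\<Sum>v\<in>{v\<in>row_box n L U. v \<in> interlaced n x}. of_bool (x (Suc n) = c)
         * (K v * (Q powi (rowsum n x + c - rowsum n v) * det1 n (\<lambda>i j. H' i (x j)))))"
    if x: "x \<in> row_box (Suc n) L U" for x
  proof (cases "strictly_decr (Suc n) x")
    case True
    then show ?thesis
      unfolding detH'[OF True] sub[OF x, symmetric] GT_sum.simps sum_distrib_right
      by (intro sum.cong refl) (simp add: K_def Q_def)
  next
    case False
    have "interlaced n x = {}"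
    proof (rule ccontr)
      assume "interlaced n x \<noteq> {}"
      then obtain v where v: "v \<in> interlaced n x" by auto
      have "x (Suc j) < x j" if "1 \<le> j" "j < Suc n" for j
      proof -
        have "v j \<in> {x (Suc j)<..x j}" using v that by (simp add: interlaced_def PiE_iff)
        then show ?thesis by auto
      qed
      then show False using False by (simp add: strictly_decr_def)
    qed
    then show ?thesis using False unfolding sub[OF x, symmetric] by (simp add: GT_sum_eq_0)
  qed
  have inner: "(\<Sum>x\<in>{x\<in>row_box (Suc n) L U. v \<in> interlaced n x}. of_bool (x (Suc n) = c)
         * (K v * (Q powi (rowsum n x + c - rowsum n v) * det1 n (\<lambda>i j. H' i (x j)))))
     = Q powi c * (GT_sum q n (\<lambda>z. of_bool (n = 0 \<or> c < z n) * f (z(Suc n := c))) v * det1 n (\<lambda>i j. H i (v j)))"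
    if v: "v \<in> row_box n L U" for v
  proof (cases "strictly_decr n v \<and> (n = 0 \<or> c < v n)")
    case True
    then have dv: "strictly_decr n v" and cv: "n = 0 \<or> c < v n" by auto
    have vLU: "L \<le> v j \<and> v j \<le> U" if "1 \<le> j" "j \<le> n" for j
      using v that by (simp add: row_box_def PiE_iff)
    \<comment> \<open>\<open>x j\<close> runs through \<open>{v j..<b j}\<close>. All functions vanish at \<open>U + 1\<close>, so there is no upper boundary
      term for \<open>j = 1\<close>.\<close>
    define b where "b j = (if j = 1 then U + 1 else v (j - 1))" for j
    have vb: "v j \<le> b j" if "1 \<le> j" "j \<le> n" for j
    proof (cases "j = 1")
      case False
      then have "1 \<le> j - 1" "j - 1 < j" using that by auto
      then show ?thesis using strictly_decr_less[OF dv, of "j - 1" j] that False by (simp add: b_def)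
    qed (use vLU[of j] that in \<open>simp add: b_def\<close>)
    have bU: "b j \<le> U + 1" if "1 \<le> j" "j \<le> n" for j
    proof (cases "j = 1")
      case False
      then have "1 \<le> j - 1" "j - 1 \<le> n" using that by auto
      then show ?thesis using vLU[of "j - 1"] False by (simp add: b_def)
    qed (simp add: b_def)
    have cw: "c < v j" if "1 \<le> j" "j \<le> n" for j
      using cv strictly_decr_less[OF dv, of j n] that by (cases "j = n") auto
    define S where "S = {x\<in>row_box (Suc n) L U. v \<in> interlaced n x \<and> x (Suc n) = c}"
    have bij: "(\<Sum>x\<in>S. Q powi (rowsum n x - rowsum n v) * det1 n (\<lambda>i j. H' i (x j)))
       = (\<Sum>x\<in>PiE {1..n} (\<lambda>j. {v j..<b j}). Q powi (rowsum n x - rowsum n v) * det1 n (\<lambda>i j. H' i (x j)))"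
    proof (rule sum.reindex_bij_witness[of _ "\<lambda>x. x(Suc n := c)" "\<lambda>x. restrict x {1..n}"])
      fix x assume x: "x \<in> S"
      show "(restrict x {1..n})(Suc n := c) = x"
        using x by (auto simp: S_def row_box_def PiE_iff extensional_def fun_eq_iff)
      have "x j \<in> {v j..<b j}" if j: "j \<in> {1..n}" for j
      proof -
        have "v j \<in> {x (Suc j)<..x j}" "x j \<le> U" using x j by (simp_all add: S_def interlaced_def row_box_def PiE_iff)
        moreover have "x j < v (j - 1)" if "j \<noteq> 1"
        proof -
          obtain i where i: "j = Suc i" "i \<in> {1..n}" using j \<open>j \<noteq> 1\<close> by (cases j) auto
          then have "v i \<in> {x (Suc i)<..x i}" using x by (simp add: S_def interlaced_def PiE_iff)
          then show ?thesis by (simp add: i)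
        qed
        ultimately show ?thesis using j by (auto simp: b_def)
      qed
      then show "restrict x {1..n} \<in> PiE {1..n} (\<lambda>j. {v j..<b j})" by simp
      have r: "rowsum n (restrict x {1..n}) = rowsum n x" by simp
      have d: "det1 n (\<lambda>i j. H' i (restrict x {1..n} j)) = det1 n (\<lambda>i j. H' i (x j))"
        by (rule det1_cong) simp
      show "Q powi (rowsum n (restrict x {1..n}) - rowsum n v) * det1 n (\<lambda>i j. H' i (restrict x {1..n} j))
          = Q powi (rowsum n x - rowsum n v) * det1 n (\<lambda>i j. H' i (x j))" unfolding r d ..
    next
      fix x assume x: "x \<in> PiE {1..n} (\<lambda>j. {v j..<b j})"
      show "restrict (x(Suc n := c)) {1..n} = x"
        using x by (auto simp: PiE_iff extensional_def fun_eq_iff restrict_def)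
      have xj: "v j \<le> x j \<and> x j < b j" if "1 \<le> j" "j \<le> n" for j
        using x that by (simp add: PiE_iff)
      have "(x(Suc n := c)) j \<in> {L..U}" if j: "j \<in> {1..Suc n}" for j
      proof (cases "j = Suc n")
        case False
        then show ?thesis using j xj[of j] vLU[of j] bU[of j] by auto
      qed (use c in simp)
      moreover have "v j \<in> {(x(Suc n := c)) (Suc j)<..(x(Suc n := c)) j}" if j: "j \<in> {1..n}" for j
        using j xj[of j] xj[of "Suc j"] cw[of j] by (auto simp: b_def)
      ultimately show "x(Suc n := c) \<in> S"
        using x v by (auto simp: S_def row_box_def interlaced_def PiE_iff extensional_def)
    qed
    have "(\<Sum>x\<in>{x\<in>row_box (Suc n) L U. v \<in> interlaced n x}. of_bool (x (Suc n) = c)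
         * (K v * (Q powi (rowsum n x + c - rowsum n v) * det1 n (\<lambda>i j. H' i (x j)))))
       = (\<Sum>x\<in>S. K v * (Q powi (rowsum n x + c - rowsum n v) * det1 n (\<lambda>i j. H' i (x j))))"
      unfolding S_def by (rule sum.mono_neutral_cong_right) auto
    also have "\<dots> = (\<Sum>x\<in>S. Q powi c * K v * (Q powi (rowsum n x - rowsum n v) * det1 n (\<lambda>i j. H' i (x j))))"
    proof (rule sum.cong[OF refl])
      fix x
      have "Q powi (rowsum n x + c - rowsum n v) = Q powi c * Q powi (rowsum n x - rowsum n v)"
        using Q by (subst power_int_add[symmetric]) (auto simp: algebra_simps)
      then show "K v * (Q powi (rowsum n x + c - rowsum n v) * det1 n (\<lambda>i j. H' i (x j)))
        = Q powi c * K v * (Q powi (rowsum n x - rowsum n v) * det1 n (\<lambda>i j. H' i (x j)))" by simp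
    qed
    also have "\<dots> = Q powi c * K v * (\<Sum>x\<in>PiE {1..n} (\<lambda>j. {v j..<b j}).
          Q powi (rowsum n x - rowsum n v) * det1 n (\<lambda>i j. H' i (x j)))"
      unfolding bij[symmetric] sum_distrib_left ..
    also have "(\<Sum>x\<in>PiE {1..n} (\<lambda>j. {v j..<b j}). Q powi (rowsum n x - rowsum n v) * det1 n (\<lambda>i j. H' i (x j)))
       = (\<Sum>x\<in>PiE {1..n} (\<lambda>j. {v j..<b j}). (\<Prod>j\<in>{1..n}. Q powi (x j - v j)) * det1 n (\<lambda>i j. H' i (x j)))"
      using Q by (subst powi_rowsum_diff) auto
    also have "\<dots> = det1 n (\<lambda>i j. \<Sum>m\<in>{v j..<b j}. Q powi (m - v j) * H' i m)"
      by (rule det1_multilinear[symmetric]) simp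
    also have "\<dots> = det1 n (\<lambda>i j. H i (v j) - (if j = 1 then 0 else Q powi (v (j - 1) - v j) * H i (v (j - 1))))"
    proof (rule det1_cong)
      fix i j assume ij: "1 \<le> i" "i \<le> n" "1 \<le> j" "j \<le> n"
      have "(\<Sum>m\<in>{v j..<b j}. Q powi (m - v j) * H' i m)
         = (\<Sum>m\<in>{v j..<b j}. Q powi (m - v j) * H i m - Q powi (m + 1 - v j) * H i (m + 1))"
      proof (rule sum.cong[OF refl])
        fix m
        have "Q powi (m + 1 - v j) = Q powi (m - v j) * Q"
          using Q power_int_add_1[of Q "m - v j"] by (simp add: algebra_simps)
        then show "Q powi (m - v j) * H' i m = Q powi (m - v j) * H i m - Q powi (m + 1 - v j) * H i (m + 1)"
          using ij by (simp add: H' algebra_simps)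
      qed
      also have "\<dots> = H i (v j) - Q powi (b j - v j) * H i (b j)"
        by (subst sum_telescope_int[where \<phi> = "\<lambda>m. Q powi (m - v j) * H i m"]) (use vb ij in auto)
      also have "Q powi (b j - v j) * H i (b j) = (if j = 1 then 0 else Q powi (v (j - 1) - v j) * H i (v (j - 1)))"
        using initial_Psi_support[of i n q y "U + 1"] Suc.prems(3)[of i] ij by (auto simp: b_def H_def)
      finally show "(\<Sum>m\<in>{v j..<b j}. Q powi (m - v j) * H' i m)
        = H i (v j) - (if j = 1 then 0 else Q powi (v (j - 1) - v j) * H i (v (j - 1)))" .
    qed
    also have "\<dots> = det1 n (\<lambda>i j. H i (v j))"
      by (rule det1_subtract_previous_col)
    finally have E: "(\<Sum>x\<in>{x\<in>row_box (Suc n) L U. v \<in> interlaced n x}. of_bool (x (Suc n) = c)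
         * (K v * (Q powi (rowsum n x + c - rowsum n v) * det1 n (\<lambda>i j. H' i (x j)))))
       = Q powi c * K v * det1 n (\<lambda>i j. H i (v j))" .
    have "K v = GT_sum q n (\<lambda>z. of_bool (n = 0 \<or> c < z n) * f (z(Suc n := c))) v"
    proof (cases "n = 0")
      case False
      then show ?thesis using cv unfolding K_def by (intro GT_sum_last_cong) auto
    qed (simp add: K_def)
    then show ?thesis by (subst E) (simp only: mult.assoc)
  next
    case False
    have lhs: "of_bool (x (Suc n) = c) * (K v * a) = 0" if "v \<in> interlaced n x" for x and a :: real
    proof (cases "strictly_decr n v")
      case True
      then have "n \<noteq> 0" "\<not> c < v n" using False by auto
      moreover have "n \<noteq> 0 \<Longrightarrow> v n \<in> {x (Suc n)<..x n}" using that by (simp add: interlaced_def PiE_iff)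
      ultimately show ?thesis by auto
    qed (simp add: K_def GT_sum_eq_0)
    have "GT_sum q n (\<lambda>z. of_bool (n = 0 \<or> c < z n) * f (z(Suc n := c))) v = 0"
    proof (cases "strictly_decr n v")
      case True
      then have "n \<noteq> 0" "\<not> c < v n" using False by auto
      then have "GT_sum q n (\<lambda>z. of_bool (n = 0 \<or> c < z n) * f (z(Suc n := c))) v = GT_sum q n (\<lambda>_. 0) v"
        by (intro GT_sum_last_cong) auto
      then show ?thesis by simp
    qed (simp add: GT_sum_eq_0)
    moreover have "(\<Sum>x\<in>{x\<in>row_box (Suc n) L U. v \<in> interlaced n x}. of_bool (x (Suc n) = c)
         * (K v * (Q powi (rowsum n x + c - rowsum n v) * det1 n (\<lambda>i j. H' i (x j))))) = 0"
      by (intro sum.neutral ballI lhs) simp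
    ultimately show ?thesis by (simp only: mult_zero_left mult_zero_right)
  qed
  have "(\<Sum>x\<in>row_box (Suc n) L U. GT_sum q (Suc n) f x * det1 (Suc n) (\<lambda>i j. H' i (x j)))
     = (\<Sum>x\<in>row_box (Suc n) L U. \<Sum>v\<in>{v\<in>row_box n L U. v \<in> interlaced n x}. of_bool (x (Suc n) = c)
         * (K v * (Q powi (rowsum n x + c - rowsum n v) * det1 n (\<lambda>i j. H' i (x j)))))"
    by (rule sum.cong[OF refl]) (rule summand)
  also have "\<dots> = (\<Sum>v\<in>row_box n L U. \<Sum>x\<in>{x\<in>row_box (Suc n) L U. v \<in> interlaced n x}. of_bool (x (Suc n) = c)
         * (K v * (Q powi (rowsum n x + c - rowsum n v) * det1 n (\<lambda>i j. H' i (x j)))))"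
    by (rule sum.swap_restrict) simp_all
  also have "\<dots> = Q powi c * (\<Sum>v\<in>row_box n L U. GT_sum q n (\<lambda>z. of_bool (n = 0 \<or> c < z n) * f (z(Suc n := c))) v * det1 n (\<lambda>i j. H i (v j)))"
    unfolding sum_distrib_left by (rule sum.cong[OF refl]) (rule inner)
  finally have main: "(\<Sum>x\<in>row_box (Suc n) L U. GT_sum q (Suc n) f x * det1 (Suc n) (\<lambda>i j. H' i (x j)))
     = Q powi c * (\<Sum>v\<in>row_box n L U. GT_sum q n (\<lambda>z. of_bool (n = 0 \<or> c < z n) * f (z(Suc n := c))) v * det1 n (\<lambda>i j. H i (v j)))" .
  have IH: "(\<Sum>v\<in>row_box n L U. GT_sum q n (\<lambda>z. of_bool (n = 0 \<or> c < z n) * f (z(Suc n := c))) v * det1 n (\<lambda>i j. H i (v j)))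
      * (\<Prod>k\<in>{1..n}. q k powi (int k - y k)) = of_bool (n = 0 \<or> c < start_position n y n) * f ((start_position n y)(Suc n := c))"
    unfolding H_def
  proof (rule Suc.IH)
    show "L \<le> y k - int n \<and> y k - int k \<le> U" if "1 \<le> k" "k \<le> n" for k
      using Suc.prems(3)[of k] that by auto
  qed (use weyl Suc.prems(2) in auto)
  have "n = 0 \<or> c < start_position n y n"
    using weyl_chamber_antimono[OF Suc.prems(1), of n "Suc n"] by (auto simp: start_position_def c_def)
  moreover have "(start_position n y)(Suc n := c) = start_position (Suc n) y"
    by (auto simp: start_position_def c_def fun_eq_iff)
  moreover have "Q powi c * Q powi (int (Suc n) - y (Suc n)) = 1"
    using Q by (subst power_int_add[symmetric]) (auto simp: c_def)
  ultimately show ?case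
    using IH main unfolding H'_def[symmetric]
    by (simp add: Q_def[symmetric] ac_simps)
qed

section \<open>The functions Psi and the weight of a configuration\<close>

lemma infsum_finite_support:
  fixes f :: "'a \<Rightarrow> real"
  assumes "finite F" "\<And>y. y \<notin> F \<Longrightarrow> f y = 0"
  shows "(\<Sum>\<^sub>\<infinity>y. f y) = sum f F"
proof -
  have "(\<Sum>\<^sub>\<infinity>y. f y) = infsum f F" using assms(2) by (intro infsum_cong_neutral) auto
  then show ?thesis using assms(1) by simp
qed

lemma kcomp_kid_left [simp]: "kcomp kid B = B"
proof (intro ext)
  fix x z show "kcomp kid B x z = B x z"
    unfolding kcomp_def by (subst infsum_finite_support[of "{x}"]) (auto simp: kid_def)
qed

lemma kcomp_Qinv: "kcomp (Qinv c) B x z = c * B (x + 1) z - B x z"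
  unfolding kcomp_def by (subst infsum_finite_support[of "{x, x + 1}"]) (auto simp: Qinv_def)

lemma kcomp_Rstar: "kcomp (Rstar c) B x z = B x z + c * B (x - 1) z"
  unfolding kcomp_def
  by (subst infsum_finite_support[of "{x, x - 1}"]) (auto simp: Rstar_def Rker_def)

lemma kprod_self [simp]: "kprod K a a = kid"
  by (cases a) simp_all

lemma kprod_Suc: "a \<le> b \<Longrightarrow> kprod K a (Suc b) = kcomp (K (Suc b)) (kprod K a b)"
  by simp

text \<open>
  Makes the infinite sum in \<open>kcomp\<close> finite, so that it can be split by linearity.
\<close>

lemma finite_support_kprod_Rstar: "finite {y. kprod (\<lambda>i. Rstar (p i)) r t x y \<noteq> 0}"
proof (induction t arbitrary: x)
  case 0
  show ?case by (rule finite_subset[of _ "{x}"]) (auto simp: kid_def)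
next
  case (Suc t)
  show ?case
  proof (cases "t < r")
    case True
    then have "kprod (\<lambda>i. Rstar (p i)) r (Suc t) = kid" by simp
    then show ?thesis by (simp add: kid_def)
  next
    case False
    then have r: "r \<le> t" by simp
    have "{m. kprod (\<lambda>i. Rstar (p i)) r (Suc t) x m \<noteq> 0}
      \<subseteq> {m. kprod (\<lambda>i. Rstar (p i)) r t x m \<noteq> 0} \<union> {m. kprod (\<lambda>i. Rstar (p i)) r t (x - 1) m \<noteq> 0}"
      unfolding kprod_Suc[OF r] kcomp_Rstar by auto
    then show ?thesis using Suc[of x] Suc[of "x - 1"] by (rule finite_subset[OF _ finite_UnI])
  qed
qed

text \<open>
  The sign turns \<open>Qinv\<close> into the difference \<open>B x - q * B (x + 1)\<close>.
\<close>

definition signed_Psi :: "(nat \<Rightarrow> real) \<Rightarrow> (nat \<Rightarrow> real) \<Rightarrow> nat \<Rightarrow> nat \<Rightarrow> (nat \<Rightarrow> int) \<Rightarrow> nat \<Rightarrow> nat \<Rightarrow> int \<Rightarrow> real" where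
  "signed_Psi p q r N y t i x = (- 1) ^ (N - i) * Psi p q r t N y i x"

lemma signed_Psi_initial:
  assumes "1 \<le> i" "i \<le> N"
  shows "signed_Psi p q r N y r i x = initial_Psi q y N i x"
proof -
  have "(- 1) ^ (N - i) * kprod (\<lambda>j. Qinv (q j)) i N x (y i - int i) = initial_Psi q y N i x"
    using assms(2)
  proof (induction N arbitrary: x)
    case (Suc n)
    show ?case
    proof (cases "i = Suc n")
      case False
      then have "i \<le> n" using Suc.prems by simp
      then have "(- 1) ^ (Suc n - i) * kprod (\<lambda>j. Qinv (q j)) i (Suc n) x (y i - int i)
        = (- 1) ^ (n - i) * kprod (\<lambda>j. Qinv (q j)) i n x (y i - int i)
          - q (Suc n) * ((- 1) ^ (n - i) * kprod (\<lambda>j. Qinv (q j)) i n (x + 1) (y i - int i))"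
        unfolding kprod_Suc[OF \<open>i \<le> n\<close>] kcomp_Qinv by (simp add: Suc_diff_le algebra_simps)
      then show ?thesis using Suc.IH[OF \<open>i \<le> n\<close>] False by simp
    qed (auto simp: kid_def)
  qed (use assms(1) in simp)
  then show ?thesis by (simp add: signed_Psi_def Psi_def)
qed

lemma signed_Psi_Suc:
  assumes "r \<le> t"
  shows "signed_Psi p q r N y (Suc t) i x = signed_Psi p q r N y t i x + p (Suc t) * signed_Psi p q r N y t i (x - 1)"
proof -
  define A where "A = kprod (\<lambda>i. Rstar (p i)) r t"
  define B where "B m = kprod (\<lambda>j. Qinv (q j)) i N m (y i - int i)" for m
  define F where "F = {m. A x m \<noteq> 0} \<union> {m. A (x - 1) m \<noteq> 0}"
  have F: "finite F" unfolding F_def A_def using finite_support_kprod_Rstar by blast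
  have "Psi p q r (Suc t) N y i x = (\<Sum>\<^sub>\<infinity>m. (A x m + p (Suc t) * A (x - 1) m) * B m)"
    unfolding Psi_def kprod_Suc[OF assms] by (subst kcomp_def) (simp add: kcomp_Rstar A_def B_def)
  also have "\<dots> = (\<Sum>m\<in>F. (A x m + p (Suc t) * A (x - 1) m) * B m)"
    by (rule infsum_finite_support[OF F]) (simp add: F_def)
  also have "\<dots> = (\<Sum>m\<in>F. A x m * B m) + p (Suc t) * (\<Sum>m\<in>F. A (x - 1) m * B m)"
    by (simp add: distrib_right sum.distrib sum_distrib_left mult.assoc)
  also have "(\<Sum>m\<in>F. A x m * B m) = Psi p q r t N y i x"
    unfolding Psi_def kcomp_def A_def[symmetric] B_def[symmetric]
    by (rule infsum_finite_support[OF F, symmetric]) (simp add: F_def)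
  also have "(\<Sum>m\<in>F. A (x - 1) m * B m) = Psi p q r t N y i (x - 1)"
    unfolding Psi_def kcomp_def A_def[symmetric] B_def[symmetric]
    by (rule infsum_finite_support[OF F, symmetric]) (simp add: F_def)
  finally show ?thesis by (simp add: signed_Psi_def distrib_left)
qed

lemma signed_Psi_support:
  assumes "r \<le> t" "1 \<le> i" "i \<le> N" "signed_Psi p q r N y t i x \<noteq> 0"
  shows "y i - int N \<le> x \<and> x \<le> y i - int i + int (t - r)"
  using assms(1,4)
proof (induction t arbitrary: x rule: dec_induct)
  case base
  then show ?case using initial_Psi_support[of i N q y x] assms by (simp add: signed_Psi_initial)
next
  case (step t)
  then have "signed_Psi p q r N y t i x \<noteq> 0 \<or> signed_Psi p q r N y t i (x - 1) \<noteq> 0"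
    using signed_Psi_Suc[of r t p q N y i x] by auto
  then show ?case using step.IH[of x] step.IH[of "x - 1"] step.hyps by (auto simp: Suc_diff_le)
qed

definition pattern_weight :: "(nat \<Rightarrow> real) \<Rightarrow> nat \<Rightarrow> (nat \<times> nat \<Rightarrow> int) \<Rightarrow> real" where
  "pattern_weight q n X =
     (\<Prod>k\<in>{1..n}. q k powi (rowsum k (\<lambda>j. X (k, j)) - rowsum (k - 1) (\<lambda>j. X (k - 1, j))))"

lemma strictly_decr_config_row:
  assumes "X \<in> configs N" "k \<le> N"
  shows "strictly_decr k (\<lambda>j. X (k, j))"
  unfolding strictly_decr_def
proof (intro allI impI)
  fix j assume j: "1 \<le> j \<and> j < k"
  then obtain m where m: "k = Suc m" by (cases k) auto
  have "X (Suc m, Suc j) < X (m, j) \<and> X (m, j) \<le> X (Suc m, j)"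
    using assms j m by (auto simp: configs_def)
  then show "X (k, Suc j) < X (k, j)" by (simp add: m)
qed

lemma config_diagonal:
  assumes "X \<in> configs N" "1 \<le> k" "k \<le> n" "n \<le> N"
  shows "X (n, n) \<le> X (k, k)"
  using assms(3,4)
proof (induction n rule: dec_induct)
  case (step n)
  have "X (Suc n, Suc n) < X (n, n)" using assms step by (auto simp: configs_def)
  then show ?case using step by simp
qed simp

text \<open>
  Interlacing makes \<open>Qdag\<close> vanish above the diagonal and gives a power of \<open>c\<close> on the diagonal. The
  last row of the matrix belongs to the virtual entry \<open>x0 - Suc m\<close> of the shorter row, and \<open>low\<close> plays the
  part of interlacing there.
\<close>

lemma det1_Qdag:
  assumes "c > 0" and X: "X \<in> configs N" and "m < N" and low: "x0 - int (Suc m) \<le> X (Suc m, Suc m)"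
  shows "det1 (Suc m) (\<lambda>i j. Qdag c (entry x0 X m i) (entry x0 X (Suc m) j))
       = c powi (rowsum (Suc m) (\<lambda>j. X (Suc m, j)) - rowsum m (\<lambda>j. X (m, j)) - x0 + int (Suc m))"
proof -
  have inter: "X (Suc m, Suc i) < X (m, i)" "X (m, i) \<le> X (Suc m, i)" if "1 \<le> i" "i \<le> m" for i
    using X that \<open>m < N\<close> by (auto simp: configs_def)
  have row: "strictly_decr (Suc m) (\<lambda>j. X (Suc m, j))" using strictly_decr_config_row[OF X] \<open>m < N\<close> by simp
  have "det1 (Suc m) (\<lambda>i j. Qdag c (entry x0 X m i) (entry x0 X (Suc m) j))
      = (\<Prod>j\<in>{1..Suc m}. Qdag c (entry x0 X m j) (entry x0 X (Suc m) j))"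
  proof (rule det1_lower_triangular)
    fix i j assume ij: "1 \<le> i" "i < j" "j \<le> Suc m"
    have "X (Suc m, j) \<le> X (Suc m, Suc i)"
      using strictly_decr_less[OF row, of "Suc i" j] ij by (cases "j = Suc i") auto
    then show "Qdag c (entry x0 X m i) (entry x0 X (Suc m) j) = 0"
      using inter[of i] ij by (simp add: Qdag_def entry_def)
  qed
  also have "\<dots> = (\<Prod>j\<in>{1..Suc m}. c powi (entry x0 X (Suc m) j - entry x0 X m j))"
  proof (rule prod.cong[OF refl])
    fix j assume "j \<in> {1..Suc m}"
    then show "Qdag c (entry x0 X m j) (entry x0 X (Suc m) j) = c powi (entry x0 X (Suc m) j - entry x0 X m j)"
      using inter[of j] low by (cases "j = Suc m") (auto simp: Qdag_def entry_def)
  qed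
  also have "\<dots> = c powi (rowsum (Suc m) (entry x0 X (Suc m)) - rowsum (Suc m) (entry x0 X m))"
    using assms(1) by (simp only: powi_rowsum_diff)
  also have "rowsum (Suc m) (entry x0 X (Suc m)) = rowsum (Suc m) (\<lambda>j. X (Suc m, j))"
    by (rule sum.cong) (auto simp: entry_def)
  also have "rowsum (Suc m) (entry x0 X m) = rowsum m (entry x0 X m) + (x0 - int (Suc m))"
    by (simp add: entry_def)
  also have "rowsum m (entry x0 X m) = rowsum m (\<lambda>j. X (m, j))"
    by (rule sum.cong) (auto simp: entry_def)
  finally show ?thesis by (simp add: algebra_simps)
qed

text \<open>
  If the last determinant is nonzero, its last column is, so the last entry of the top row is at least
  \<open>y N - N\<close>, hence at least \<open>x0\<close>. The diagonal of a configuration decreases, so \<open>det1_Qdag\<close> applies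
  to every row. The right-hand side is free of \<open>x0\<close>.
\<close>

lemma config_weight_eq:
  assumes "1 \<le> N" and q: "\<And>j. 1 \<le> j \<Longrightarrow> j \<le> N \<Longrightarrow> q j > 0" and "r \<le> t"
    and y: "y \<in> weyl_chamber N" and x0: "x0 - 1 < y N - int N" and X: "X \<in> configs N"
  shows "config_weight p q r t N y x0 X =
     (\<Prod>k\<in>{1..N}. q k powi (int k - y k)) / Zpart p q N r t
       * (pattern_weight q N X * det1 N (\<lambda>i j. signed_Psi p q r N y t i (X (N, j))))"
proof -
  define D where "D = det1 N (\<lambda>i j. signed_Psi p q r N y t i (X (N, j)))"
  have D: "det1 N (\<lambda>i j. (- 1) ^ (N - i) * Psi p q r t N y i (entry x0 X N j)) = D"
    unfolding D_def by (rule det1_cong) (simp add: signed_Psi_def entry_def)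
  show ?thesis
  proof (cases "D = 0")
    case True
    then show ?thesis unfolding config_weight_def D by (simp add: D_def)
  next
    case False
    have "y N - int N \<le> X (N, N)"
    proof (rule ccontr)
      assume "\<not> y N - int N \<le> X (N, N)"
      then have "signed_Psi p q r N y t i (X (N, N)) = 0" if "1 \<le> i" "i \<le> N" for i
        using signed_Psi_support[OF \<open>r \<le> t\<close> that, of p q y "X (N, N)"] weyl_chamber_antimono[OF y that(1), of N] that
        by force
      then have "D = 0" unfolding D_def using \<open>1 \<le> N\<close> by (intro det1_zero_col[of N]) auto
      then show False using False by simp
    qed
    then have low: "x0 - int k \<le> X (k, k)" if "1 \<le> k" "k \<le> N" for k
      using config_diagonal[OF X that] x0 that by simp
    have "(\<Prod>k\<in>{1..N}. det1 k (\<lambda>i j. Qdag (q k) (entry x0 X (k - 1) i) (entry x0 X k j)))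
      = (\<Prod>k\<in>{1..N}. q k powi (rowsum k (\<lambda>j. X (k, j)) - rowsum (k - 1) (\<lambda>j. X (k - 1, j)))
           * (q k powi (int k - y k) * q k powi (y k - x0)))"
    proof (rule prod.cong[OF refl])
      fix k assume k: "k \<in> {1..N}"
      then obtain m where m: "k = Suc m" by (cases k) auto
      have qk: "q k > 0" using q k by simp
      have "det1 k (\<lambda>i j. Qdag (q k) (entry x0 X (k - 1) i) (entry x0 X k j))
        = q k powi (rowsum k (\<lambda>j. X (k, j)) - rowsum (k - 1) (\<lambda>j. X (k - 1, j)) - x0 + int k)"
        using det1_Qdag[OF qk X, of m x0] low[of k] k by (simp add: m)
      also have "rowsum k (\<lambda>j. X (k, j)) - rowsum (k - 1) (\<lambda>j. X (k - 1, j)) - x0 + int k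
        = (rowsum k (\<lambda>j. X (k, j)) - rowsum (k - 1) (\<lambda>j. X (k - 1, j))) + ((int k - y k) + (y k - x0))"
        by simp
      also have "q k powi \<dots> = q k powi (rowsum k (\<lambda>j. X (k, j)) - rowsum (k - 1) (\<lambda>j. X (k - 1, j)))
           * (q k powi (int k - y k) * q k powi (y k - x0))"
        using qk by (simp only: power_int_add[OF disjI1] less_imp_neq[symmetric] not_False_eq_True)
      finally show "det1 k (\<lambda>i j. Qdag (q k) (entry x0 X (k - 1) i) (entry x0 X k j))
        = q k powi (rowsum k (\<lambda>j. X (k, j)) - rowsum (k - 1) (\<lambda>j. X (k - 1, j)))
           * (q k powi (int k - y k) * q k powi (y k - x0))" .
    qed
    also have "\<dots> = pattern_weight q N X * ((\<Prod>k\<in>{1..N}. q k powi (int k - y k)) * (\<Prod>k\<in>{1..N}. q k powi (y k - x0)))"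
      by (simp add: prod.distrib pattern_weight_def)
    finally have *: "(\<Prod>k\<in>{1..N}. det1 k (\<lambda>i j. Qdag (q k) (entry x0 X (k - 1) i) (entry x0 X k j)))
      = pattern_weight q N X * ((\<Prod>k\<in>{1..N}. q k powi (int k - y k)) * (\<Prod>k\<in>{1..N}. q k powi (y k - x0)))" .
    have "(\<Prod>k\<in>{1..N}. q k powi (y k - x0)) \<noteq> 0"
    proof -
      have "0 < (\<Prod>k\<in>{1..N}. q k powi (y k - x0))" using q by (intro prod_pos) simp
      then show ?thesis by linarith
    qed
    then show ?thesis unfolding config_weight_def D * Zhat_def D_def[symmetric] by (simp add: field_simps)
  qed
qed

definition configs_with_top_row :: "nat \<Rightarrow> (nat \<Rightarrow> int) \<Rightarrow> (nat \<times> nat \<Rightarrow> int) set" where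
  "configs_with_top_row n x = {X \<in> configs n. \<forall>j\<in>{1..n}. X (n, j) = x j}"

definition diagonal :: "nat \<Rightarrow> (nat \<times> nat \<Rightarrow> int) \<Rightarrow> nat \<Rightarrow> int" where
  "diagonal n X k = (if 1 \<le> k \<and> k \<le> n then X (k, k) else 0)"

definition add_row :: "nat \<Rightarrow> (nat \<Rightarrow> int) \<Rightarrow> (nat \<times> nat \<Rightarrow> int) \<Rightarrow> nat \<times> nat \<Rightarrow> int" where
  "add_row n x X = (\<lambda>(i, j). if i = n \<and> 1 \<le> j \<and> j \<le> n then x j else X (i, j))"

text \<open>
  Removing the top row of a configuration leaves a configuration whose own top row interlaces with
  it. This is the recursion of \<open>GT_sum\<close> on the level of sets.
\<close>

lemma configs_with_top_row_Suc:
  "configs_with_top_row (Suc n) x = (\<lambda>(v, X). add_row (Suc n) x X) ` Sigma (interlaced n x) (configs_with_top_row n)"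
  (is "?L = ?R")
proof (intro equalityI subsetI)
  fix X assume X: "X \<in> ?L"
  then have XC: "X \<in> configs (Suc n)" and Xx: "\<And>j. 1 \<le> j \<Longrightarrow> j \<le> Suc n \<Longrightarrow> X (Suc n, j) = x j"
    by (auto simp: configs_with_top_row_def)
  have inter: "X (Suc i, Suc j) < X (i, j) \<and> X (i, j) \<le> X (Suc i, j)" if "1 \<le> j" "j \<le> i" "i \<le> n" for i j
    using XC that by (auto simp: configs_def)
  define X' where "X' = restrict X {(i, j). 1 \<le> j \<and> j \<le> i \<and> i \<le> n}"
  define v where "v = restrict (\<lambda>j. X (n, j)) {1..n}"
  have X': "X' (i, j) = X (i, j)" if "1 \<le> j" "j \<le> i" "i \<le> n" for i j
    using that by (simp add: X'_def)
  have "X' \<in> configs_with_top_row n v"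
    using inter X' by (auto simp: configs_with_top_row_def configs_def v_def) (auto simp: X'_def)
  moreover have "v \<in> interlaced n x"
    using inter[of _ n] Xx by (auto simp: interlaced_def v_def)
  moreover have "add_row (Suc n) x X' = X"
  proof
    fix a :: "nat \<times> nat"
    obtain i j where a: "a = (i, j)" by (cases a)
    have "X a = undefined" if "\<not> (1 \<le> j \<and> j \<le> i \<and> i \<le> Suc n)"
      using XC that a by (auto simp: configs_def extensional_def)
    then show "add_row (Suc n) x X' a = X a"
      using Xx[of j] by (auto simp: add_row_def a X'_def le_Suc_eq)
  qed
  ultimately show "X \<in> ?R" by (intro image_eqI[of _ _ "(v, X')"]) auto
next
  fix X assume "X \<in> ?R"
  then obtain v X' where v: "v \<in> interlaced n x" and X': "X' \<in> configs_with_top_row n v"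
    and X: "X = add_row (Suc n) x X'" by auto
  have X1: "X (Suc n, j) = x j" if "1 \<le> j" "j \<le> Suc n" for j using that by (simp add: X add_row_def)
  have X2: "X (i, j) = X' (i, j)" if "i \<le> n" for i j using that by (simp add: X add_row_def)
  have v': "x (Suc j) < v j \<and> v j \<le> x j" if "1 \<le> j" "j \<le> n" for j
    using v that by (simp add: interlaced_def PiE_iff)
  have row: "X' (n, j) = v j" if "1 \<le> j" "j \<le> n" for j
    using X' that by (simp add: configs_with_top_row_def)
  have "X (Suc i, Suc j) < X (i, j) \<and> X (i, j) \<le> X (Suc i, j)" if "1 \<le> j" "j \<le> i" "i < Suc n" for i j
  proof (cases "i = n")
    case True
    then show ?thesis using that v'[of j] row[of j] by (simp add: X1 X2)
  next
    case False
    then show ?thesis using that X' by (simp add: X2 configs_with_top_row_def configs_def)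
  qed
  moreover have "X \<in> extensional {(i, j). 1 \<le> j \<and> j \<le> i \<and> i \<le> Suc n}"
    using X' by (auto simp: X add_row_def configs_with_top_row_def configs_def extensional_def)
  ultimately show "X \<in> ?L" using X1 by (auto simp: configs_with_top_row_def configs_def)
qed

lemma inj_add_row:
  "inj_on (\<lambda>(v, X). add_row (Suc n) x X) (Sigma (interlaced n x) (configs_with_top_row n))"
proof (rule inj_onI, clarify)
  fix v X v' X'
  assume v: "v \<in> interlaced n x" "v' \<in> interlaced n x" and X: "X \<in> configs_with_top_row n v" "X' \<in> configs_with_top_row n v'"
    and eq: "add_row (Suc n) x X = add_row (Suc n) x X'"
  have X1: "X (i, j) = X' (i, j)" for i j
  proof (cases "i \<le> n")
    case True
    then show ?thesis using fun_cong[OF eq, of "(i, j)"] by (simp add: add_row_def)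
  next
    case False
    then show ?thesis using X by (auto simp: configs_with_top_row_def configs_def extensional_def)
  qed
  then have "X = X'" by auto
  moreover have "v j = v' j" for j
  proof (cases "j \<in> {1..n}")
    case True
    then have "X (n, j) = v j" "X' (n, j) = v' j" using X by (simp_all add: configs_with_top_row_def)
    then show ?thesis using X1 by simp
  next
    case False
    then show ?thesis using v by (auto simp: interlaced_def PiE_iff extensional_def)
  qed
  ultimately show "v = v' \<and> X = X'" by auto
qed

lemma configs_with_top_row_0: "configs_with_top_row 0 x = {\<lambda>_. undefined}"
proof -
  have E: "{(i::nat, j::nat). 1 \<le> j \<and> j \<le> i \<and> i \<le> 0} = {}" by auto
  show ?thesis unfolding configs_with_top_row_def configs_def E extensional_empty by auto
qed

lemma finite_configs_with_top_row [simp]: "finite (configs_with_top_row n x)"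
  by (induction n arbitrary: x)
     (simp_all add: configs_with_top_row_0 configs_with_top_row_Suc)

lemma GT_sum_eq_sum_configs:
  "GT_sum q n f x = (\<Sum>X\<in>configs_with_top_row n x. pattern_weight q n X * f (diagonal n X))"
proof (induction n arbitrary: x f)
  case 0
  have "diagonal 0 X = (\<lambda>_. 0)" for X by (simp add: diagonal_def fun_eq_iff)
  then show ?case by (simp add: configs_with_top_row_0 pattern_weight_def)
next
  case (Suc n)
  have "(\<Sum>X\<in>configs_with_top_row (Suc n) x. pattern_weight q (Suc n) X * f (diagonal (Suc n) X))
    = (\<Sum>(v, X)\<in>Sigma (interlaced n x) (configs_with_top_row n).
         pattern_weight q (Suc n) (add_row (Suc n) x X) * f (diagonal (Suc n) (add_row (Suc n) x X)))"
    unfolding configs_with_top_row_Suc by (subst sum.reindex[OF inj_add_row]) (simp add: case_prod_beta o_def)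
  also have "\<dots> = (\<Sum>(v, X)\<in>Sigma (interlaced n x) (configs_with_top_row n).
         q (Suc n) powi (rowsum (Suc n) x - rowsum n v) * (pattern_weight q n X * f ((diagonal n X)(Suc n := x (Suc n)))))"
  proof (rule sum.cong[OF refl], clarify)
    fix v X assume "v \<in> interlaced n x" and X: "X \<in> configs_with_top_row n v"
    define X' where "X' = add_row (Suc n) x X"
    have X1: "X' (Suc n, j) = x j" if "1 \<le> j" "j \<le> Suc n" for j using that by (simp add: X'_def add_row_def)
    have X2: "X' (i, j) = X (i, j)" if "i \<le> n" for i j using that by (simp add: X'_def add_row_def)
    have d: "diagonal (Suc n) X' = (diagonal n X)(Suc n := x (Suc n))"
      by (auto simp: diagonal_def fun_eq_iff X1 X2)
    have "pattern_weight q n X' = pattern_weight q n X"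
      unfolding pattern_weight_def
    proof (rule prod.cong[OF refl])
      fix k assume "k \<in> {1..n}"
      then have "X' (k, j) = X (k, j)" "X' (k - 1, j) = X (k - 1, j)" for j by (auto intro!: X2)
      then show "q k powi (rowsum k (\<lambda>j. X' (k, j)) - rowsum (k - 1) (\<lambda>j. X' (k - 1, j)))
          = q k powi (rowsum k (\<lambda>j. X (k, j)) - rowsum (k - 1) (\<lambda>j. X (k - 1, j)))" by simp
    qed
    moreover have "rowsum (Suc n) (\<lambda>j. X' (Suc n, j)) = rowsum (Suc n) x"
      by (rule sum.cong[OF refl]) (simp add: X1)
    moreover have "rowsum n (\<lambda>j. X' (n, j)) = rowsum n v"
      using X by (intro sum.cong[OF refl]) (simp add: X2 configs_with_top_row_def)
    moreover have "pattern_weight q (Suc n) X' = pattern_weight q n X' *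
        q (Suc n) powi (rowsum (Suc n) (\<lambda>j. X' (Suc n, j)) - rowsum n (\<lambda>j. X' (n, j)))"
      by (simp add: pattern_weight_def)
    ultimately have w: "pattern_weight q (Suc n) X' = pattern_weight q n X * q (Suc n) powi (rowsum (Suc n) x - rowsum n v)"
      by (simp only:)
    show "pattern_weight q (Suc n) (add_row (Suc n) x X) * f (diagonal (Suc n) (add_row (Suc n) x X))
       = q (Suc n) powi (rowsum (Suc n) x - rowsum n v) * (pattern_weight q n X * f ((diagonal n X)(Suc n := x (Suc n))))"
      unfolding X'_def[symmetric] d w by (simp add: ac_simps)
  qed
  also have "\<dots> = GT_sum q (Suc n) f x"
    by (subst sum.Sigma[symmetric]) (simp_all add: Suc sum_distrib_left)
  finally show ?case by simp
qed

section \<open>The law of dTASEP as a finite sum over noise\<close>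

text \<open>
  The expectation of \<open>f\<close> at the positions at time \<open>t\<close>, multiplied by \<open>Zpart p q N r t\<close>: \<open>B\<close> is the set of
  pairs (time, particle) at which a jump is attempted.
\<close>

definition noise_sum :: "(nat \<Rightarrow> real) \<Rightarrow> (nat \<Rightarrow> real) \<Rightarrow> nat \<Rightarrow> nat \<Rightarrow> nat \<Rightarrow> (nat \<Rightarrow> int) \<Rightarrow> ((nat \<Rightarrow> int) \<Rightarrow> real) \<Rightarrow> real" where
  "noise_sum p q N r t Y f =
     (\<Sum>B\<in>Pow ({r<..t} \<times> {1..N}). (\<Prod>(s, k)\<in>B. p s * q k) * f (dtasep (\<lambda>s k. (s, k) \<in> B) r Y t))"

lemma dtasep_cong:
  assumes "\<And>s k. r < s \<Longrightarrow> s \<le> t \<Longrightarrow> 1 \<le> k \<Longrightarrow> k \<le> N \<Longrightarrow> w s k \<longleftrightarrow> w' s k" "1 \<le> k" "k \<le> N"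
  shows "dtasep w r Y t k = dtasep w' r Y t k"
  using assms
proof (induction t arbitrary: k)
  case (Suc t)
  show ?case
  proof (cases "t < r")
    case False
    have "dtasep_step (w (Suc t)) (dtasep w r Y t) k = dtasep_step (w' (Suc t)) (dtasep w' r Y t) k"
    proof (rule dtasep_step_cong[of N])
      fix k assume "1 \<le> k" "k \<le> N"
      then show "(w (Suc t) k \<longleftrightarrow> w' (Suc t) k) \<and> dtasep w r Y t k = dtasep w' r Y t k"
        using Suc.IH[of k] Suc.prems(1) False by auto
    qed (use Suc.prems in auto)
    then show ?thesis using False by simp
  qed simp
qed simp

lemma dtasep_le [simp]: "t \<le> r \<Longrightarrow> dtasep w r Y t = Y"
  by (cases t) auto

lemma noise_sum_initial: "noise_sum p q N r r Y f = f Y"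
  by (simp add: noise_sum_def)

text \<open>
  Splitting the noise into the part up to time \<open>t\<close> and the part at time \<open>Suc t\<close> is the Markov property.
\<close>

lemma noise_sum_Suc:
  assumes "r \<le> t" and f: "depends_on_first N f"
  shows "noise_sum p q N r (Suc t) Y f = noise_sum p q N r t Y (step_operator (\<lambda>k. p (Suc t) * q k) N f)"
proof -
  define J where "J = {r<..t} \<times> {1..N}"
  have fin: "finite J" by (simp add: J_def)
  have J': "{r<..Suc t} \<times> {1..N} = J \<union> {Suc t} \<times> {1..N}"
    using assms(1) by (auto simp: J_def)
  have "noise_sum p q N r (Suc t) Y f = (\<Sum>(B, w)\<in>Pow J \<times> Pow {1..N}.
      ((\<Prod>(s, k)\<in>B. p s * q k) * (\<Prod>k\<in>w. p (Suc t) * q k)) * f (dtasep_step (\<lambda>k. k \<in> w) (dtasep (\<lambda>s k. (s, k) \<in> B) r Y t)))"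
    unfolding noise_sum_def J'
  proof (rule sum.reindex_bij_witness[of _ "\<lambda>(B, w). B \<union> {Suc t} \<times> w" "\<lambda>B. (B \<inter> J, {k. (Suc t, k) \<in> B})"])
    fix B assume "B \<in> Pow (J \<union> {Suc t} \<times> {1..N})"
    then have B: "B \<subseteq> J \<union> {Suc t} \<times> {1..N}" by simp
    define w where "w = {k. (Suc t, k) \<in> B}"
    have Beq: "B = (B \<inter> J) \<union> {Suc t} \<times> w" using B by (auto simp: w_def J_def)
    then show "(case (B \<inter> J, {k. (Suc t, k) \<in> B}) of (B, w) \<Rightarrow> B \<union> {Suc t} \<times> w) = B" by (simp add: w_def)
    have wN: "w \<subseteq> {1..N}" using B by (auto simp: w_def J_def)
    then show "(B \<inter> J, {k. (Suc t, k) \<in> B}) \<in> Pow J \<times> Pow {1..N}" by (simp add: w_def)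
    have finw: "finite w" using wN finite_subset by blast
    have "(\<Prod>(s, k)\<in>B. p s * q k) = (\<Prod>(s, k)\<in>B \<inter> J. p s * q k) * (\<Prod>(s, k)\<in>{Suc t} \<times> w. p s * q k)"
      using finw fin by (subst Beq, intro prod.union_disjoint) (auto simp: J_def)
    also have "(\<Prod>(s, k)\<in>{Suc t} \<times> w. p s * q k) = (\<Prod>k\<in>w. p (Suc t) * q k)"
      by (simp add: prod.cartesian_product[symmetric])
    finally have pr: "(\<Prod>(s, k)\<in>B. p s * q k) = (\<Prod>(s, k)\<in>B \<inter> J. p s * q k) * (\<Prod>k\<in>w. p (Suc t) * q k)" .
    have "dtasep (\<lambda>s k. (s, k) \<in> B) r Y (Suc t) k
        = dtasep_step (\<lambda>k. k \<in> w) (dtasep (\<lambda>s k. (s, k) \<in> B \<inter> J) r Y t) k" if "k \<in> {1..N}" for k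
    proof -
      have "dtasep (\<lambda>s k. (s, k) \<in> B) r Y t k = dtasep (\<lambda>s k. (s, k) \<in> B \<inter> J) r Y t k"
        if "1 \<le> k" "k \<le> N" for k
        by (rule dtasep_cong[of r t N]) (use that in \<open>auto simp: J_def\<close>)
      then have "dtasep_step (\<lambda>k. (Suc t, k) \<in> B) (dtasep (\<lambda>s k. (s, k) \<in> B) r Y t) k
        = dtasep_step (\<lambda>k. k \<in> w) (dtasep (\<lambda>s k. (s, k) \<in> B \<inter> J) r Y t) k"
        using that by (intro dtasep_step_cong[of N]) (auto simp: w_def)
      then show ?thesis using assms(1) by simp
    qed
    then have "f (dtasep (\<lambda>s k. (s, k) \<in> B) r Y (Suc t))
        = f (dtasep_step (\<lambda>k. k \<in> w) (dtasep (\<lambda>s k. (s, k) \<in> B \<inter> J) r Y t))"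
      using f unfolding depends_on_first_def by blast
    then show "(case (B \<inter> J, {k. (Suc t, k) \<in> B}) of (B, w) \<Rightarrow>
        ((\<Prod>(s, k)\<in>B. p s * q k) * (\<Prod>k\<in>w. p (Suc t) * q k)) * f (dtasep_step (\<lambda>k. k \<in> w) (dtasep (\<lambda>s k. (s, k) \<in> B) r Y t)))
      = (\<Prod>(s, k)\<in>B. p s * q k) * f (dtasep (\<lambda>s k. (s, k) \<in> B) r Y (Suc t))"
      by (simp only: pr w_def[symmetric] prod.case)
  next
    fix Bw assume "Bw \<in> Pow J \<times> Pow {1..N}"
    then obtain B w where Bw: "Bw = (B, w)" "B \<subseteq> J" "w \<subseteq> {1..N}" by auto
    show "((case Bw of (B, w) \<Rightarrow> B \<union> {Suc t} \<times> w) \<inter> J, {k. (Suc t, k) \<in> (case Bw of (B, w) \<Rightarrow> B \<union> {Suc t} \<times> w)}) = Bw"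
      using Bw by (auto simp: J_def)
    show "(case Bw of (B, w) \<Rightarrow> B \<union> {Suc t} \<times> w) \<in> Pow (J \<union> {Suc t} \<times> {1..N})"
      using Bw by auto
  qed
  also have "\<dots> = noise_sum p q N r t Y (step_operator (\<lambda>k. p (Suc t) * q k) N f)"
    unfolding noise_sum_def step_operator_def J_def[symmetric]
    by (simp only: sum.cartesian_product[symmetric] sum_distrib_left mult.assoc)
  finally show ?thesis .
qed

text \<open>
  The event is the disjoint union, over the noise patterns \<open>B\<close> that lead to the target, of the events that
  the jump variables realise \<open>B\<close>. By independence such an event has as probability the product of the
  factors \<open>p s * q k / (1 + p s * q k)\<close> over \<open>B\<close> and \<open>1 / (1 + p s * q k)\<close> over the complement, and the
  denominators multiply to \<open>Zpart\<close>.
\<close>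

lemma dtasep_prob_eq_noise_sum:
  assumes noise: "dtasep_noise M p q N W" and "r < t" "1 \<le> N"
    and p: "\<And>i. 1 \<le> i \<Longrightarrow> p i > 0" and q: "\<And>j. 1 \<le> j \<Longrightarrow> j \<le> N \<Longrightarrow> q j > 0"
  shows "dtasep_prob M W N r t y y' = noise_sum p q N r t (\<lambda>k. y k - int k)
           (\<lambda>z. of_bool (\<forall>k\<in>{1..N}. z k = y' k - int k)) / Zpart p q N r t"
proof -
  interpret prob_space M using noise by (simp add: dtasep_noise_def)
  define J where "J = {r<..t} \<times> {1..N}"
  define Y where "Y = (\<lambda>k. y k - int k)"
  define f :: "(nat \<Rightarrow> int) \<Rightarrow> real" where "f = (\<lambda>z. of_bool (\<forall>k\<in>{1..N}. z k = y' k - int k))"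
  define V where "V = (\<lambda>(s, k). W s k)"
  define E where "E B = (\<Inter>j\<in>J. V j -` {j \<in> B} \<inter> space M)" for B
  have J: "finite J" "J \<noteq> {}" "J \<subseteq> {1..} \<times> {1..N}"
    using assms(2,3) by (auto simp: J_def)
  have iv: "indep_vars (\<lambda>_. count_space UNIV) V ({1..} \<times> {1..N})"
    using noise by (simp add: dtasep_noise_def V_def)
  have V: "V j \<in> measurable M (count_space UNIV)" if "j \<in> J" for j
    using iv J(3) that unfolding indep_vars_def by auto
  have E_sets: "E B \<in> events" for B
    unfolding E_def using J V by (intro sets.finite_INT) auto
  have pr: "prob (V (s, k) -` {b} \<inter> space M) = (if b then p s * q k else 1) / (1 + p s * q k)"
    if "(s, k) \<in> J" for s k b
  proof -
    have sk: "1 \<le> s" "1 \<le> k" "k \<le> N" using J that by auto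
    have pos: "p s * q k > 0" using p q sk by simp
    then have pq: "0 \<le> p s * q k / (1 + p s * q k)" "p s * q k / (1 + p s * q k) \<le> 1" by simp_all
    have "prob (V (s, k) -` {b} \<inter> space M) = measure (distr M (count_space UNIV) (V (s, k))) {b}"
      using V[OF that] by (subst measure_distr) auto
    also have "distr M (count_space UNIV) (V (s, k)) = measure_pmf (bernoulli_pmf (p s * q k / (1 + p s * q k)))"
      using noise sk by (simp add: dtasep_noise_def V_def)
    also have "measure (measure_pmf (bernoulli_pmf (p s * q k / (1 + p s * q k)))) {b}
       = (if b then p s * q k else 1) / (1 + p s * q k)"
      using pos pq by (cases b) (simp_all add: measure_pmf_single field_simps)
    finally show ?thesis .
  qed
  have probE: "prob (E B) = (\<Prod>(s, k)\<in>B. p s * q k) / Zpart p q N r t" if B: "B \<subseteq> J" for B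
  proof -
    have "prob (E B) = (\<Prod>j\<in>J. prob (V j -` {j \<in> B} \<inter> space M))"
      unfolding E_def by (rule indep_varsD[OF iv]) (use J in auto)
    also have "\<dots> = (\<Prod>(s, k)\<in>J. (if (s, k) \<in> B then p s * q k else 1) / (1 + p s * q k))"
      by (rule prod.cong[OF refl]) (auto simp: pr split del: if_split)
    also have "\<dots> = (\<Prod>(s, k)\<in>J. if (s, k) \<in> B then p s * q k else 1) / (\<Prod>(s, k)\<in>J. 1 + p s * q k)"
      by (simp add: case_prod_beta prod_dividef)
    also have "(\<Prod>(s, k)\<in>J. 1 + p s * q k) = Zpart p q N r t"
      by (simp add: Zpart_def J_def prod.cartesian_product)
    also have "(\<Prod>(s, k)\<in>J. if (s, k) \<in> B then p s * q k else 1) = (\<Prod>(s, k)\<in>B. p s * q k)"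
      using J B by (intro prod.mono_neutral_cong_right) auto
    finally show ?thesis .
  qed
  have E_iff: "\<omega> \<in> E B \<longleftrightarrow> \<omega> \<in> space M \<and> (\<forall>j\<in>J. V j \<omega> \<longleftrightarrow> j \<in> B)" for \<omega> B
    using J(2) by (auto simp: E_def)
  define S where "S = {B \<in> Pow J. f (dtasep (\<lambda>s k. (s, k) \<in> B) r Y t) = 1}"
  have f_dtasep: "f (dtasep (\<lambda>s k. W s k \<omega>) r Y t) = f (dtasep (\<lambda>s k. (s, k) \<in> B) r Y t)"
    if "\<omega> \<in> E B" for \<omega> B
  proof -
    have "dtasep (\<lambda>s k. W s k \<omega>) r Y t k = dtasep (\<lambda>s k. (s, k) \<in> B) r Y t k" if "1 \<le> k" "k \<le> N" for k
    proof (rule dtasep_cong[of r t N])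
      fix s k assume "r < s" "s \<le> t" "1 \<le> k" "k \<le> N"
      then have "(s, k) \<in> J" by (simp add: J_def)
      then show "W s k \<omega> \<longleftrightarrow> (s, k) \<in> B" using \<open>\<omega> \<in> E B\<close> unfolding E_iff V_def by auto
    qed (use that in auto)
    then show ?thesis by (simp add: f_def)
  qed
  have "{\<omega>\<in>space M. \<forall>k\<in>{1..N}. dtasep (\<lambda>s k. W s k \<omega>) r Y t k = y' k - int k} = (\<Union>B\<in>S. E B)"
  proof (intro equalityI subsetI)
    fix \<omega> assume w: "\<omega> \<in> {\<omega>\<in>space M. \<forall>k\<in>{1..N}. dtasep (\<lambda>s k. W s k \<omega>) r Y t k = y' k - int k}"
    then have "f (dtasep (\<lambda>s k. W s k \<omega>) r Y t) = 1" by (simp add: f_def)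
    moreover have wE: "\<omega> \<in> E {j \<in> J. V j \<omega>}" using w by (simp add: E_iff)
    ultimately have "f (dtasep (\<lambda>s k. (s, k) \<in> {j \<in> J. V j \<omega>}) r Y t) = 1"
      by (intro trans[OF f_dtasep[OF wE, symmetric]])
    moreover have "{j \<in> J. V j \<omega>} \<in> Pow J" by auto
    ultimately have "{j \<in> J. V j \<omega>} \<in> S" unfolding S_def by (intro CollectI conjI)
    then show "\<omega> \<in> (\<Union>B\<in>S. E B)" using wE by (rule UN_I)
  next
    fix \<omega> assume "\<omega> \<in> (\<Union>B\<in>S. E B)"
    then obtain B where B: "B \<in> S" "\<omega> \<in> E B" by auto
    then have "f (dtasep (\<lambda>s k. W s k \<omega>) r Y t) = 1" using f_dtasep by (simp add: S_def)
    then show "\<omega> \<in> {\<omega>\<in>space M. \<forall>k\<in>{1..N}. dtasep (\<lambda>s k. W s k \<omega>) r Y t k = y' k - int k}"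
      using B(2) by (simp add: f_def E_iff)
  qed
  then have "dtasep_prob M W N r t y y' = prob (\<Union>B\<in>S. E B)" by (simp add: dtasep_prob_def Y_def)
  also have "\<dots> = (\<Sum>B\<in>S. prob (E B))"
  proof (rule finite_measure_finite_Union)
    show "finite S" using J by (simp add: S_def)
    show "disjoint_family_on E S"
    proof (unfold disjoint_family_on_def, intro ballI impI)
      fix B B' assume "B \<in> S" "B' \<in> S" "B \<noteq> B'"
      then have "B \<subseteq> J" "B' \<subseteq> J" by (auto simp: S_def)
      then obtain j where "j \<in> J" "j \<in> B \<longleftrightarrow> j \<notin> B'" using \<open>B \<noteq> B'\<close> by blast
      then show "E B \<inter> E B' = {}" by (auto simp: E_iff)
    qed
  qed (use E_sets in auto)
  also have "\<dots> = (\<Sum>B\<in>S. (\<Prod>(s, k)\<in>B. p s * q k) / Zpart p q N r t)"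
    by (rule sum.cong[OF refl], rule probE) (simp add: S_def)
  also have "\<dots> = (\<Sum>B\<in>Pow J. (\<Prod>(s, k)\<in>B. p s * q k) * f (dtasep (\<lambda>s k. (s, k) \<in> B) r Y t) / Zpart p q N r t)"
  proof (rule sum.mono_neutral_cong_left)
    have f01: "f z = 0 \<or> f z = 1" for z unfolding f_def of_bool_def by presburger
    show "finite (Pow J)" "S \<subseteq> Pow J" using J by (auto simp: S_def)
    show "\<forall>B\<in>Pow J - S. (\<Prod>(s, k)\<in>B. p s * q k) * f (dtasep (\<lambda>s k. (s, k) \<in> B) r Y t) / Zpart p q N r t = 0"
    proof
      fix B assume "B \<in> Pow J - S"
      then have "f (dtasep (\<lambda>s k. (s, k) \<in> B) r Y t) = 0"
        using f01[of "dtasep (\<lambda>s k. (s, k) \<in> B) r Y t"] by (simp add: S_def)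
      then show "(\<Prod>(s, k)\<in>B. p s * q k) * f (dtasep (\<lambda>s k. (s, k) \<in> B) r Y t) / Zpart p q N r t = 0"
        by simp
    qed
    fix B assume "B \<in> S"
    then show "(\<Prod>(s, k)\<in>B. p s * q k) / Zpart p q N r t
        = (\<Prod>(s, k)\<in>B. p s * q k) * f (dtasep (\<lambda>s k. (s, k) \<in> B) r Y t) / Zpart p q N r t"
      by (simp add: S_def)
  qed
  also have "\<dots> = noise_sum p q N r t Y f / Zpart p q N r t"
    by (simp add: noise_sum_def J_def sum_divide_distrib)
  finally show ?thesis unfolding Y_def f_def .
qed

text \<open>
  Both sides satisfy the same recursion in \<open>t\<close>, with \<open>f\<close> replaced by its image under the transition
  operator; this is why \<open>f\<close> is arbitrary. The box of rows grows by one on the right per time step, as the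
  support of \<open>Psi\<close> does.
\<close>

lemma noise_sum_eq_GT_sum:
  assumes "y \<in> weyl_chamber N" and p: "\<And>i. 1 \<le> i \<Longrightarrow> p i > 0"
    and q: "\<And>k. 1 \<le> k \<Longrightarrow> k \<le> N \<Longrightarrow> q k > 0"
    and window: "\<And>k. 1 \<le> k \<Longrightarrow> k \<le> N \<Longrightarrow> L \<le> y k - int N \<and> y k - int k \<le> U"
    and "r \<le> t" and "depends_on_first N f"
  shows "(\<Sum>x\<in>row_box N L (U + int (t - r)). GT_sum q N f x * det1 N (\<lambda>i j. signed_Psi p q r N y t i (x j)))
           * (\<Prod>k\<in>{1..N}. q k powi (int k - y k)) = noise_sum p q N r t (\<lambda>k. y k - int k) f"
  using assms(5,6)
proof (induction t arbitrary: f rule: dec_induct)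
  case base
  have "det1 N (\<lambda>i j. signed_Psi p q r N y r i (x j)) = det1 N (\<lambda>i j. initial_Psi q y N i (x j))" for x
    by (rule det1_cong) (simp add: signed_Psi_initial)
  moreover have "f (start_position N y) = f (\<lambda>k. y k - int k)"
    using base unfolding depends_on_first_def by (auto simp: start_position_def)
  ultimately show ?case using initial_condition[OF assms(1) q window, where f = f]
    by (simp add: noise_sum_initial)
next
  case (step t)
  have "(\<Sum>x\<in>row_box N L (U + int (t - r) + 1). GT_sum q N f x * det1 N (\<lambda>i j. signed_Psi p q r N y (Suc t) i (x j)))
      = (\<Sum>x\<in>row_box N L (U + int (t - r)). GT_sum q N (step_operator (\<lambda>k. p (Suc t) * q k) N f) x
           * det1 N (\<lambda>i j. signed_Psi p q r N y t i (x j)))"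
  proof (rule time_step)
    show "signed_Psi p q r N y (Suc t) i x = signed_Psi p q r N y t i x + p (Suc t) * signed_Psi p q r N y t i (x - 1)" for i x
      by (rule signed_Psi_Suc) (use step in simp)
    show "L \<le> x \<and> x \<le> U + int (t - r)" if "1 \<le> i" "i \<le> N" "signed_Psi p q r N y t i x \<noteq> 0" for i x
      using signed_Psi_support[OF step.hyps(1) that] window[OF that(1,2)] by auto
  qed (use p q step in auto)
  note evolve = this
  have shift: "U + int (Suc t - r) = U + int (t - r) + 1" using step.hyps by (simp add: Suc_diff_le)
  show ?case
    unfolding shift evolve noise_sum_Suc[OF step.hyps(1) step.prems]
    by (rule step.IH[OF depends_on_first_step_operator[OF step.prems]])
qed

theorem proposition3p6:
  fixes N r t :: nat and p q :: "nat \<Rightarrow> real" and y :: "nat \<Rightarrow> int" and x0 :: int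
    and M :: "'w measure" and W :: "nat \<Rightarrow> nat \<Rightarrow> 'w \<Rightarrow> bool"
  assumes "2 \<le> N"
    and "\<And>i. 1 \<le> i \<Longrightarrow> 0 < p i"
    and "\<And>j. 1 \<le> j \<Longrightarrow> j \<le> N \<Longrightarrow> 1 < q j"
    and "r < t"
    and "y \<in> weyl_chamber N"
    and "x0 - 1 < y N - int N"
  shows "(\<forall>x0'. x0' - 1 < y N - int N \<longrightarrow>
            (\<forall>X\<in>configs N. config_weight p q r t N y x0' X = config_weight p q r t N y x0 X)) \<and>
         (dtasep_noise M p q N W \<longrightarrow>
            (\<forall>y'\<in>weyl_chamber N.
               (config_weight p q r t N y x0 has_sum dtasep_prob M W N r t y y')
                 {X \<in> configs N. \<forall>i\<in>{1..N}. X (i, i) = y' i - int i}))"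
proof (intro conjI allI impI ballI)
  have q: "q j > 0" if "1 \<le> j" "j \<le> N" for j using assms(3)[OF that] by simp
  note weight = config_weight_eq[where q = q, OF _ q less_imp_le[OF assms(4)] assms(5)]
  show "config_weight p q r t N y x0' X = config_weight p q r t N y x0 X"
    if "x0' - 1 < y N - int N" "X \<in> configs N" for x0' X
    using assms(1) weight[OF _ _ _ that] weight[OF _ _ _ assms(6) that(2)] by simp
  fix y' assume noise: "dtasep_noise M p q N W" and "y' \<in> weyl_chamber N"
  define D where "D x = det1 N (\<lambda>i j. signed_Psi p q r N y t i (x j))" for x
  define C where "C = (\<Prod>k\<in>{1..N}. q k powi (int k - y k)) / Zpart p q N r t"
  define f :: "(nat \<Rightarrow> int) \<Rightarrow> real" where "f = (\<lambda>z. of_bool (\<forall>k\<in>{1..N}. z k = y' k - int k))"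
  \<comment> \<open>Rows outside the box with these bounds have determinant \<open>0\<close>; this reduces the sum to a finite one.\<close>
  define L where "L = y N - int N"
  define U where "U = y 1"
  define Bx where "Bx = row_box N L (U + int (t - r))"
  define S where "S = {X \<in> configs N. \<forall>i\<in>{1..N}. X (i, i) = y' i - int i}"
  define row where "row X = restrict (\<lambda>j. X (N, j)) {1..N}" for X :: "nat \<times> nat \<Rightarrow> int"
  have window: "L \<le> y k - int N \<and> y k - int k \<le> U" if "1 \<le> k" "k \<le> N" for k
    using weyl_chamber_antimono[OF assms(5) that] weyl_chamber_antimono[OF assms(5), of 1 k] that
    by (auto simp: L_def U_def)
  have W: "config_weight p q r t N y x0 X = C * (pattern_weight q N X * D (row X))" if "X \<in> configs N" for X
  proof -
    have "det1 N (\<lambda>i j. signed_Psi p q r N y t i (X (N, j))) = D (row X)"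
      unfolding D_def by (rule det1_cong) (simp add: row_def)
    then show ?thesis using weight[OF _ _ _ assms(6) that] assms(1) by (simp add: C_def)
  qed
  have D0: "D x = 0" if x: "x \<in> extensional {1..N}" "x \<notin> Bx" for x
  proof -
    obtain j where j: "1 \<le> j" "j \<le> N" "x j \<notin> {L..U + int (t - r)}"
      using x by (auto simp: Bx_def row_box_def PiE_iff)
    have "signed_Psi p q r N y t i (x j) = 0" if "1 \<le> i" "i \<le> N" for i
    proof (rule ccontr)
      assume "signed_Psi p q r N y t i (x j) \<noteq> 0"
      from signed_Psi_support[OF less_imp_le[OF assms(4)] that this] window[OF that] j show False by auto
    qed
    then show ?thesis unfolding D_def using j by (intro det1_zero_col[of j]) auto
  qed
  define T where "T = (\<Union>x\<in>Bx. configs_with_top_row N x)"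
  have finB: "finite Bx" by (simp add: Bx_def)
  have rowx: "row X = x" if "X \<in> configs_with_top_row N x" "x \<in> Bx" for X x
    using that by (auto simp: row_def configs_with_top_row_def Bx_def row_box_def PiE_iff extensional_def fun_eq_iff restrict_def)
  have T: "X \<in> T \<longleftrightarrow> X \<in> configs N \<and> row X \<in> Bx" for X
  proof
    assume "X \<in> T"
    then obtain x where x: "x \<in> Bx" "X \<in> configs_with_top_row N x" by (auto simp: T_def)
    then show "X \<in> configs N \<and> row X \<in> Bx" using rowx[OF x(2,1)] by (simp add: configs_with_top_row_def)
  next
    assume "X \<in> configs N \<and> row X \<in> Bx"
    moreover have "X \<in> configs N \<Longrightarrow> X \<in> configs_with_top_row N (row X)" by (simp add: configs_with_top_row_def row_def)
    ultimately show "X \<in> T" by (auto simp: T_def)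
  qed
  have finT: "finite T" using finB by (simp add: T_def)
  have fX: "f (diagonal N X) = of_bool (X \<in> S)" if "X \<in> configs N" for X
    using that by (simp add: f_def diagonal_def S_def)
  have "(\<Sum>X\<in>S \<inter> T. config_weight p q r t N y x0 X) = (\<Sum>X\<in>T. C * (pattern_weight q N X * f (diagonal N X) * D (row X)))"
    using finT by (intro sum.mono_neutral_cong_left) (auto simp: W T fX)
  also have "\<dots> = (\<Sum>x\<in>Bx. \<Sum>X\<in>configs_with_top_row N x. C * (pattern_weight q N X * f (diagonal N X) * D (row X)))"
    unfolding T_def
  proof (rule sum.UNION_disjoint[OF finB])
    show "\<forall>x\<in>Bx. \<forall>x'\<in>Bx. x \<noteq> x' \<longrightarrow> configs_with_top_row N x \<inter> configs_with_top_row N x' = {}"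
      using rowx by blast
  qed simp
  also have "\<dots> = (\<Sum>x\<in>Bx. C * (GT_sum q N f x * D x))"
  proof (rule sum.cong[OF refl])
    fix x assume x: "x \<in> Bx"
    have "(\<Sum>X\<in>configs_with_top_row N x. C * (pattern_weight q N X * f (diagonal N X) * D (row X)))
      = (\<Sum>X\<in>configs_with_top_row N x. C * (pattern_weight q N X * f (diagonal N X) * D x))"
      using rowx x by (intro sum.cong[OF refl]) simp
    then show "(\<Sum>X\<in>configs_with_top_row N x. C * (pattern_weight q N X * f (diagonal N X) * D (row X))) = C * (GT_sum q N f x * D x)"
      by (simp only: GT_sum_eq_sum_configs sum_distrib_left sum_distrib_right)
  qed
  also have "\<dots> = (\<Sum>x\<in>Bx. GT_sum q N f x * D x) * (\<Prod>k\<in>{1..N}. q k powi (int k - y k)) / Zpart p q N r t"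
    unfolding sum_distrib_left[symmetric] C_def by simp
  also have "(\<Sum>x\<in>Bx. GT_sum q N f x * D x) * (\<Prod>k\<in>{1..N}. q k powi (int k - y k))
      = noise_sum p q N r t (\<lambda>k. y k - int k) f"
    unfolding Bx_def D_def
  proof (rule noise_sum_eq_GT_sum[OF assms(5,2)])
    show "depends_on_first N f" by (simp add: depends_on_first_def f_def)
  qed (use q window assms(4) in auto)
  also have "noise_sum p q N r t (\<lambda>k. y k - int k) f / Zpart p q N r t = dtasep_prob M W N r t y y'"
    using dtasep_prob_eq_noise_sum[OF noise assms(4) _ assms(2) q, where y = y and y' = y'] assms(1) by (simp add: f_def)
  finally have total: "(\<Sum>X\<in>S \<inter> T. config_weight p q r t N y x0 X) = dtasep_prob M W N r t y y'" .
  have "(config_weight p q r t N y x0 has_sum dtasep_prob M W N r t y y') (S \<inter> T)"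
    using finT total by (intro has_sum_finiteI) auto
  moreover have "config_weight p q r t N y x0 X = 0" if "X \<in> S - S \<inter> T" for X
  proof -
    have "X \<in> configs N" "row X \<notin> Bx" using that T[of X] by (auto simp: S_def)
    then show ?thesis using W D0[of "row X"] by (simp add: row_def)
  qed
  ultimately show "(config_weight p q r t N y x0 has_sum dtasep_prob M W N r t y y')
      {X \<in> configs N. \<forall>i\<in>{1..N}. X (i, i) = y' i - int i}"
    unfolding S_def[symmetric] by (subst has_sum_cong_neutral[of "S \<inter> T" S]) auto
qed

end
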